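(* Let $0<\alpha<2$, $\mathfrak{U}\in C^2(\mathbb{S}^1,(0,+\infty))$ and $U(x)=\mathfrak{U}(x/|x|)/|x|^{\alpha}$ on $\mathbb{R}^2\setminus\{0\}$. Let $\bar x(t)=\bar r(t)(\cos\theta_0,\sin\theta_0)$ be a homothetic zero energy solution of $\ddot x=\nabla U(x)$, where $\theta_0$ is a critical point of $\mathfrak{U}$. With $\Delta(\theta):=\frac{(2-\alpha)^2}{2}\mathfrak{U}(\theta)+4\,\mathfrak{U}_{\theta\theta}(\theta)$: (a) if $\Delta(\theta_0)<0$, then $m^-(\bar x)=+\infty$; (b) if $\Delta(\theta_0)\ge 0$, then $m^-(\bar x)=0$.
   Context: Here $\mathbb{S}^1=[-\pi,\pi]/\{\pm\pi\}$; in polar coordinates $x=(r\cos\theta,r\sin\theta)$ the function $\mathfrak{U}$ is regarded as a function of $\theta\in\mathbb{S}^1$, and subscripts $\theta$ denote derivatives. A solution $x:(T^-,T^+)\to\mathbb{R}^2\setminus\{0\}$, $-\infty\le T^-<T^+\le+\infty$, is considered on its maximal interval of existence. It has zero energy if $\frac12|\dot x|^2-U(x)\equiv 0$, and it is homothetic if $\theta(t)$ is constant on $(T^-,T^+)$. Morse index. For $T^-<t_1<t_2<T^+$ let $\mathcal{F}(x;t_1,t_2)=\int_{t_1}^{t_2}\left(\frac12|\dot x|^2+U(x)\right)dt$, and let $m^-(x;t_1,t_2)$ be the dimension of the largest subspace of $W_0^{1,2}([t_1,t_2],\mathbb{R}^2)$ on which the second derivative $d^2\mathcal{F}(x;t_1,t_2)$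 is negative definite. The Morse index of $x$ is $m^-(x)=\lim_{n\to\infty}m^-(x;t_n^-,t_n^+)\in\{0,1,2,\dots\}\cup\{+\infty\}$, where $T^-<t_n^-<t_n^+<T^+$ and $t_n^\pm\to T^\pm$ (the limit is independent of the sequences, since $m^-(x;t_1,t_2)$ is monotone under inclusion of intervals). *)

theory Defs
  imports "HOL-Analysis.Analysis"
begin

section \<open>The potential\<close>

definition circle_point :: "real \<Rightarrow> real^2" where
  "circle_point \<theta> = vector [cos \<theta>, sin \<theta>]"

text \<open>A function on the unit circle is given as a function on the plane of which only the values
  on the unit sphere are used; this is that function in the angular coordinate.\<close>

definition angular :: "(real^2 \<Rightarrow> real) \<Rightarrow> real \<Rightarrow> real" where
  "angular \<UU> \<theta> = \<UU> (circle_point \<theta>)"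

definition C2_real :: "(real \<Rightarrow> real) \<Rightarrow> bool" where
  "C2_real f \<longleftrightarrow> (\<forall>t. f differentiable (at t)) \<and> (\<forall>t. deriv f differentiable (at t))
     \<and> continuous_on UNIV (deriv (deriv f))"

text \<open>The covering of the circle by the line is a local diffeomorphism, so regularity on the
  circle is regularity in the angle.\<close>

definition C2_circle :: "(real^2 \<Rightarrow> real) \<Rightarrow> bool" where
  "C2_circle \<UU> \<longleftrightarrow> C2_real (angular \<UU>)"

text \<open>The value at the origin is irrelevant.\<close>

definition potential :: "real \<Rightarrow> (real^2 \<Rightarrow> real) \<Rightarrow> real^2 \<Rightarrow> real" where
  "potential \<alpha> \<UU> x = \<UU> (x /\<^sub>R norm x) / norm x powr \<alpha>"

definition \<Delta> :: "real \<Rightarrow> (real^2 \<Rightarrow> real) \<Rightarrow> real \<Rightarrow> real" where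
  "\<Delta> \<alpha> \<UU> \<theta> = (2 - \<alpha>)\<^sup>2 / 2 * angular \<UU> \<theta> + 4 * deriv (deriv (angular \<UU>)) \<theta>"

section \<open>Solutions\<close>

definition solution_on :: "(real^2 \<Rightarrow> real) \<Rightarrow> (real \<Rightarrow> real^2) \<Rightarrow> ereal \<Rightarrow> ereal \<Rightarrow> bool" where
  "solution_on U x Tm Tp \<longleftrightarrow> Tm < Tp \<and>
     (\<exists>v. \<forall>t\<in>einterval Tm Tp. x t \<noteq> 0 \<and> (x has_vector_derivative v t) (at t) \<and>
        (\<exists>a. GDERIV U (x t) :> a \<and> (v has_vector_derivative a) (at t)))"

definition maximal_solution :: "(real^2 \<Rightarrow> real) \<Rightarrow> (real \<Rightarrow> real^2) \<Rightarrow> ereal \<Rightarrow> ereal \<Rightarrow> bool" where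
  "maximal_solution U x Tm Tp \<longleftrightarrow> solution_on U x Tm Tp \<and>
     (\<forall>y Sm Sp. solution_on U y Sm Sp \<longrightarrow> Sm \<le> Tm \<longrightarrow> Tp \<le> Sp \<longrightarrow>
        (\<forall>t\<in>einterval Tm Tp. y t = x t) \<longrightarrow> Sm = Tm \<and> Sp = Tp)"

definition zero_energy :: "(real^2 \<Rightarrow> real) \<Rightarrow> (real \<Rightarrow> real^2) \<Rightarrow> ereal \<Rightarrow> ereal \<Rightarrow> bool" where
  "zero_energy U x Tm Tp \<longleftrightarrow>
     (\<forall>t\<in>einterval Tm Tp. 1/2 * (norm (vector_derivative x (at t)))\<^sup>2 - U (x t) = 0)"

section \<open>Sobolev spaces on an interval\<close>

text \<open>In dimension one, $W^{1,2}$ consists of the absolutely continuous functions with square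
  integrable derivative, i.e. of the indefinite integrals of functions in $L^2$. Integrability
  in the first conjunct supplies the Lebesgue measurability of the derivative.\<close>

definition has_L2_derivative ::
    "real \<Rightarrow> real \<Rightarrow> (real \<Rightarrow> real^2) \<Rightarrow> (real \<Rightarrow> real^2) \<Rightarrow> bool" where
  "has_L2_derivative a b y g \<longleftrightarrow> g absolutely_integrable_on {a..b} \<and>
     (\<lambda>t. (norm (g t))\<^sup>2) absolutely_integrable_on {a..b} \<and>
     (\<forall>t\<in>{a..b}. y t = y a + integral {a..t} g)"

definition W12 :: "real \<Rightarrow> real \<Rightarrow> (real \<Rightarrow> real^2) set" where
  "W12 a b = {y. \<exists>g. has_L2_derivative a b y g}"

text \<open>Unique up to a null set for functions in \<^const>\<open>W12\<close>.\<close>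

definition weak_derivative :: "real \<Rightarrow> real \<Rightarrow> (real \<Rightarrow> real^2) \<Rightarrow> real \<Rightarrow> real^2" where
  "weak_derivative a b y = (SOME g. has_L2_derivative a b y g)"

text \<open>Functions in $W_0^{1,2}$ are extended by zero to the whole line. They are then bounded and
  continuous, which makes the space a linear subspace of a library type.\<close>

definition W12_0 :: "real \<Rightarrow> real \<Rightarrow> (real \<Rightarrow>\<^sub>C (real^2)) set" where
  "W12_0 a b = {h. apply_bcontfun h \<in> W12 a b \<and> (\<forall>t. t \<notin> {a<..<b} \<longrightarrow> apply_bcontfun h t = 0)}"

section \<open>Morse index\<close>

definition action :: "(real^2 \<Rightarrow> real) \<Rightarrow> real \<Rightarrow> real \<Rightarrow> (real \<Rightarrow> real^2) \<Rightarrow> real" where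
  "action U a b y = integral {a..b} (\<lambda>t. 1/2 * (norm (weak_derivative a b y t))\<^sup>2 + U (y t))"

text \<open>The quadratic form $d^2\mathcal{F}(x;a,b)[h,h]$, i.e. the second derivative at $s = 0$ of the
  action of $x + s h$. For $x$ with values in the punctured plane this curve avoids the origin
  when $|s|$ is small.\<close>

definition d2_action ::
    "(real^2 \<Rightarrow> real) \<Rightarrow> (real \<Rightarrow> real^2) \<Rightarrow> real \<Rightarrow> real \<Rightarrow> (real \<Rightarrow>\<^sub>C (real^2)) \<Rightarrow> real" where
  "d2_action U x a b h =
     deriv (deriv (\<lambda>s. action U a b (\<lambda>t. x t + s *\<^sub>R apply_bcontfun h t))) 0"

text \<open>The library's \<^const>\<open>dim\<close> is 0 on infinite-dimensional spaces; this one is infinite.\<close>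

definition edim :: "'a::real_vector set \<Rightarrow> enat" where
  "edim V = (SUP B\<in>{B. B \<subseteq> V \<and> finite B \<and> independent B}. enat (card B))"

definition morse_index_on ::
    "(real^2 \<Rightarrow> real) \<Rightarrow> (real \<Rightarrow> real^2) \<Rightarrow> real \<Rightarrow> real \<Rightarrow> enat" where
  "morse_index_on U x a b =
     (SUP V\<in>{V. subspace V \<and> V \<subseteq> W12_0 a b \<and> (\<forall>h\<in>V. h \<noteq> 0 \<longrightarrow> d2_action U x a b h < 0)}. edim V)"

text \<open>The Morse index of \<open>x\<close> on $(T^-,T^+)$ exists and equals \<open>m\<close>: the indices on compact
  subintervals converge to \<open>m\<close>, for every choice of exhausting sequences.\<close>

definition has_morse_index ::
    "(real^2 \<Rightarrow> real) \<Rightarrow> (real \<Rightarrow> real^2) \<Rightarrow> ereal \<Rightarrow> ereal \<Rightarrow> enat \<Rightarrow> bool" where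
  "has_morse_index U x Tm Tp m \<longleftrightarrow>
     (\<forall>a b. (\<forall>n. Tm < ereal (a n) \<and> a n < b n \<and> ereal (b n) < Tp) \<longrightarrow>
        (\<lambda>n. ereal (a n)) \<longlonglongrightarrow> Tm \<longrightarrow> (\<lambda>n. ereal (b n)) \<longlonglongrightarrow> Tp \<longrightarrow>
        (\<lambda>n. morse_index_on U x (a n) (b n)) \<longlonglongrightarrow> m)"

end

theory Submission
  imports Defs
begin

text \<open>A zero energy homothetic motion satisfies \<open>r\<^bsup>(\<alpha>+2)/2\<^esup> = c \<bar>t - T\<bar>\<close>, where \<open>T\<close> is the collision time,
  and by maximality it lives on a half line ending at \<open>T\<close>. In the orthonormal frame of its ray the
  second variation splits into a radial part, which is nonnegative, and the angular part
  \<open>\<integral> \<eta>'\<^sup>2 + \<beta> \<eta>\<^sup>2 / (t - T)\<^sup>2\<close>, where \<open>\<beta> + 1/4\<close> is a positive multiple of \<open>\<Delta>\<close>. If \<open>\<Delta> \<ge> 0\<close>, the form is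
  nonnegative by Hardy's inequality. If \<open>\<Delta> < 0\<close>, the solutions \<open>\<bar>s\<bar>\<^bsup>1/2\<^esup> sin (\<omega> ln \<bar>s\<bar>)\<close>, \<open>s = t - T\<close>, of an
  Euler equation oscillate infinitely often on the half line, and each arc between consecutive zeros
  contributes a negative direction, for small \<open>\<omega>\<close>.\<close>

section \<open>Indefinite integrals and Hardy's inequality\<close>

text \<open>The threshold is transparent in logarithmic time: substituting
  \<open>\<eta> = \<bar>s\<bar>^(1/2) y\<close> and taking \<open>ln \<bar>s\<bar>\<close> as the
  new time turns the angular form, up to a boundary term, into the constant coefficient form with
  integrand \<open>y'^2 + (\<beta> + 1/4) y^2\<close>. Its sign on long intervals is decided by
  \<open>\<beta> + 1/4\<close>. The half line has infinite logarithmic length at both of its ends,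
  which is why the index can only be zero or infinite. The analytic obstacle is regularity. Test
  functions in \<open>W12_0\<close> have derivatives only almost everywhere, and
  \<open>d2_action\<close> is an iterated \<open>deriv\<close> of the action, not a given quadratic
  form. Hence a product rule for indefinite integrals and a differentiation under the integral along
  \<open>x + s h\<close>. For the latter the potential is written in polar coordinates around the
  ray, on the open half plane that the perturbed curve does not leave for small
  \<open>s\<close>.\<close>

lemma indefinite_integral_zero_imp_ae_zero:
  fixes g :: "real \<Rightarrow> 'a::euclidean_space"
  assumes g: "g integrable_on {a..b}" and zero: "\<And>t. t \<in> {a..b} \<Longrightarrow> integral {a..t} g = 0"
  obtains N where "negligible N" "\<And>t. t \<in> {a..b} - N \<Longrightarrow> g t = 0"
proof -
  \<comment> \<open>Extension by zero makes the Lebesgue differentiation theorem on the whole line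
    applicable: off a null set, \<open>f\<close> is the limit of its averages over right-hand
    intervals.\<close>
  define f where "f t = (if t \<in> {a..b} then g t else 0)" for t
  have "f integrable_on UNIV"
    unfolding f_def using g integrable_restrict_UNIV by blast
  then have "f integrable_on cbox c d" for c d
    using integrable_on_subcbox by blast
  then obtain N where N: "negligible N"
    "\<And>x e. \<lbrakk>x \<notin> N; 0 < e\<rbrakk> \<Longrightarrow> \<exists>d>0. \<forall>h. 0 < h \<and> h < d \<longrightarrow>
       norm (integral (cbox x (x + h *\<^sub>R One)) f /\<^sub>R h ^ DIM(real) - f x) < e"
    using integrable_ccontinuous_explicit by blast
  \<comment> \<open>Right-hand averages at \<open>b\<close> see only the extension by zero, so
    \<open>b\<close> joins the null set. To the left of \<open>b\<close>, averages over short
    intervals are differences of vanishing integrals.\<close>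
  have "g t = 0" if t: "t \<in> {a..b} - insert b N" for t
  proof (rule ccontr)
    assume "g t \<noteq> 0"
    then have "0 < norm (f t)" using t by (auto simp: f_def)
    moreover have "t \<notin> N" using t by simp
    ultimately obtain d where d: "d > 0" "\<And>h. 0 < h \<Longrightarrow> h < d \<Longrightarrow>
       norm (integral (cbox t (t + h *\<^sub>R One)) f /\<^sub>R h ^ DIM(real) - f t) < norm (f t)"
      using N(2)[of t "norm (f t)"] by metis
    define h where "h = min (d/2) (b - t)"
    have h: "0 < h" "h < d" "t + h \<le> b" using t d(1) by (auto simp: h_def min_def)
    have "integral {t..t+h} f = integral {t..t+h} g"
      using t h by (intro integral_cong) (auto simp: f_def)
    also have "integral {a..t} g + integral {t..t+h} g = integral {a..t+h} g"
      using t h by (intro Henstock_Kurzweil_Integration.integral_combine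
          integrable_on_subinterval[OF g]) auto
    then have "integral {t..t+h} g = 0"
      using zero[of t] zero[of "t+h"] t h by auto
    finally show False using d(2)[OF h(1,2)] by simp
  qed
  moreover have "negligible (insert b N)" using N(1) by simp
  ultimately show ?thesis using that by blast
qed

text \<open>Absolute continuity with density \<open>f\<close>, the scalar companion of
  \<open>has_L2_derivative\<close>. Hardy's inequality integrates the derivative of a product by
  parts, so a product rule and the fundamental theorem are required for functions whose derivative
  is known only almost everywhere.\<close>

definition has_L1_derivative :: "real \<Rightarrow> real \<Rightarrow> (real \<Rightarrow> real) \<Rightarrow> (real \<Rightarrow> real) \<Rightarrow> bool" where
  "has_L1_derivative a b F f \<longleftrightarrow> f absolutely_integrable_on {a..b} \<and>
     (\<forall>t\<in>{a..b}. F t = F a + integral {a..t} f)"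

lemma has_L1_derivative_continuous_on:
  assumes "has_L1_derivative a b F f"
  shows "continuous_on {a..b} F"
proof -
  have "continuous_on {a..b} (\<lambda>t. F a + integral {a..t} f)"
    using assms unfolding has_L1_derivative_def
    by (intro continuous_on_add continuous_on_const indefinite_integral_continuous_1
        set_lebesgue_integral_eq_integral(1)) blast
  then show ?thesis
    by (rule continuous_on_eq) (metis assms has_L1_derivative_def)
qed

lemma has_L1_derivative_increment:
  assumes F: "has_L1_derivative a b F f" and "a \<le> u" "u \<le> v" "v \<le> b"
  shows "(f has_integral F v - F u) {u..v}"
proof -
  have f: "f integrable_on {a..b}"
    using F unfolding has_L1_derivative_def by (intro set_lebesgue_integral_eq_integral(1)) blast
  have "integral {a..u} f + integral {u..v} f = integral {a..v} f"
    using assms by (intro Henstock_Kurzweil_Integration.integral_combine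
          integrable_on_subinterval[OF f]) auto
  moreover have "F u = F a + integral {a..u} f" "F v = F a + integral {a..v} f"
    using F[unfolded has_L1_derivative_def] \<open>a \<le> u\<close> \<open>u \<le> v\<close> \<open>v \<le> b\<close>
    by (meson atLeastAtMost_iff order_trans)+
  moreover have "f integrable_on {u..v}"
    using assms by (intro integrable_on_subinterval[OF f]) auto
  ultimately show ?thesis by (simp add: has_integral_iff)
qed

lemma absolutely_integrable_continuous_mult:
  fixes f G :: "real \<Rightarrow> real"
  assumes "f absolutely_integrable_on {a..b}" "continuous_on {a..b} G"
  shows "(\<lambda>t. G t * f t) absolutely_integrable_on {a..b}"
proof (rule absolutely_integrable_bounded_measurable_product_real)
  show "G \<in> borel_measurable (lebesgue_on {a..b})"
    using assms(2) by (rule continuous_imp_measurable_on_sets_lebesgue) simp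
  show "bounded (G ` {a..b})"
    using assms(2) by (intro compact_imp_bounded compact_continuous_image compact_Icc)
qed (use assms(1) in simp_all)

text \<open>The increment of the difference of the two sides over \<open>[u, v]\<close> is at most the oscillation of
  \<open>F\<close> and \<open>G\<close> there times the integral of \<open>\<bar>f\<bar> + \<bar>g\<bar>\<close>; the bound is additive in the interval, so it
  globalises by bisection.\<close>

lemma has_L1_derivative_mult:
  assumes F: "has_L1_derivative a b F f" and G: "has_L1_derivative a b G g"
  shows "has_L1_derivative a b (\<lambda>t. F t * G t) (\<lambda>t. G t * f t + F t * g t)"
proof -
  let ?h = "\<lambda>t. G t * f t + F t * g t"
  let ?m = "\<lambda>t. \<bar>f t\<bar> + \<bar>g t\<bar>"
  have cF: "continuous_on {a..b} F" and cG: "continuous_on {a..b} G"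
    using F G by (auto intro: has_L1_derivative_continuous_on)
  have f: "f absolutely_integrable_on {a..b}" and g: "g absolutely_integrable_on {a..b}"
    using F G by (auto simp: has_L1_derivative_def)
  have Gf: "(\<lambda>t. G t * f t) absolutely_integrable_on {a..b}"
    and Fg: "(\<lambda>t. F t * g t) absolutely_integrable_on {a..b}"
    by (intro absolutely_integrable_continuous_mult f g cF cG)+
  then have h: "?h absolutely_integrable_on {a..b}"
    by (rule set_integral_add)
  then have hi: "?h integrable_on {a..b}" by (rule set_lebesgue_integral_eq_integral(1))
  have m: "?m integrable_on {a..b}"
    using f g by (auto simp: absolutely_integrable_on_def intro!: integrable_add)
  define \<Phi> where "\<Phi> t = F t * G t - integral {a..t} ?h" for t
  have inc: "((\<lambda>\<tau>. (G v - G \<tau>) * f \<tau> + (F u - F \<tau>) * g \<tau>) has_integral \<Phi> v - \<Phi> u) {u..v}"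
    if "a \<le> u" "u \<le> v" "v \<le> b" for u v
  proof -
    have "integral {a..u} ?h + integral {u..v} ?h = integral {a..v} ?h"
      using that by (intro Henstock_Kurzweil_Integration.integral_combine
          integrable_on_subinterval[OF hi]) auto
    moreover have "?h integrable_on {u..v}"
      using that by (intro integrable_on_subinterval[OF hi]) auto
    ultimately have "(?h has_integral integral {a..v} ?h - integral {a..u} ?h) {u..v}"
      by (simp add: has_integral_iff)
    moreover have "((\<lambda>\<tau>. G v * f \<tau>) has_integral G v * (F v - F u)) {u..v}"
      using has_L1_derivative_increment[OF F that] by (rule has_integral_mult_right)
    moreover have "((\<lambda>\<tau>. F u * g \<tau>) has_integral F u * (G v - G u)) {u..v}"
      using has_L1_derivative_increment[OF G that] by (rule has_integral_mult_right)
    \<comment> \<open>Splitting \<open>F v * G v - F u * G u\<close> as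
      \<open>G v * (F v - F u) + F u * (G v - G u)\<close> leaves only oscillations of
      \<open>F\<close> and \<open>G\<close> over \<open>[u, v]\<close> as coefficients of
      \<open>f\<close> and \<open>g\<close>.\<close>
    ultimately have "((\<lambda>\<tau>. G v * f \<tau> + F u * g \<tau> - ?h \<tau>) has_integral
        G v * (F v - F u) + F u * (G v - G u) - (integral {a..v} ?h - integral {a..u} ?h)) {u..v}"
      by (intro has_integral_diff has_integral_add)
    then show ?thesis by (simp add: \<Phi>_def algebra_simps)
  qed
  have small: "\<bar>\<Phi> t - \<Phi> a\<bar> \<le> \<epsilon> * integral {a..t} ?m" if "\<epsilon> > 0" "t \<in> {a..b}" for \<epsilon> t
  proof -
    have "a \<le> t" using that by simp
    define P where "P u v \<longleftrightarrow> (a \<le> u \<longrightarrow> v \<le> b \<longrightarrow> \<bar>\<Phi> v - \<Phi> u\<bar> \<le> \<epsilon> * integral {u..v} ?m)" for u v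
    from \<open>a \<le> t\<close> have "P a t"
    proof (rule Bolzano)
      fix u v w assume trans: "P u v" "P v w" "u \<le> v" "v \<le> w"
      show "P u w" unfolding P_def
      proof (intro impI)
        assume "a \<le> u" "w \<le> b"
        have "integral {u..v} ?m + integral {v..w} ?m = integral {u..w} ?m"
          using trans \<open>a \<le> u\<close> \<open>w \<le> b\<close> by (intro Henstock_Kurzweil_Integration.integral_combine
          integrable_on_subinterval[OF m]) auto
        then have e: "\<epsilon> * integral {u..w} ?m = \<epsilon> * integral {u..v} ?m + \<epsilon> * integral {v..w} ?m"
          by (metis distrib_left)
        show "\<bar>\<Phi> w - \<Phi> u\<bar> \<le> \<epsilon> * integral {u..w} ?m"
          unfolding e using trans unfolding P_def using \<open>a \<le> u\<close> \<open>w \<le> b\<close> by auto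
      qed
    next
      fix x assume "a \<le> x" "x \<le> t"
      then have x: "x \<in> {a..b}" using that by auto
      from cF x \<open>\<epsilon> > 0\<close> obtain d1 where d1: "d1 > 0"
        "\<And>y. y \<in> {a..b} \<Longrightarrow> dist y x < d1 \<Longrightarrow> dist (F y) (F x) < \<epsilon>/2"
        unfolding continuous_on_iff by (meson half_gt_zero)
      from cG x \<open>\<epsilon> > 0\<close> obtain d2 where d2: "d2 > 0"
        "\<And>y. y \<in> {a..b} \<Longrightarrow> dist y x < d2 \<Longrightarrow> dist (G y) (G x) < \<epsilon>/2"
        unfolding continuous_on_iff by (meson half_gt_zero)
      show "\<exists>d>0. \<forall>u v. u \<le> x \<and> x \<le> v \<and> v - u < d \<longrightarrow> P u v"
        unfolding P_def
      proof (intro exI[of _ "min d1 d2"] conjI allI impI)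
        show "0 < min d1 d2" using d1 d2 by simp
        fix u v assume uv: "u \<le> x \<and> x \<le> v \<and> v - u < min d1 d2" and "a \<le> u" "v \<le> b"
        have FG: "\<bar>F y - F z\<bar> \<le> \<epsilon>" "\<bar>G y - G z\<bar> \<le> \<epsilon>" if "y \<in> {u..v}" "z \<in> {u..v}" for y z
        proof -
          have *: "y \<in> {a..b}" "z \<in> {a..b}" "dist y x < d1" "dist z x < d1" "dist y x < d2" "dist z x < d2"
            using that uv \<open>a \<le> u\<close> \<open>v \<le> b\<close> by (auto simp: dist_real_def)
          show "\<bar>F y - F z\<bar> \<le> \<epsilon>" "\<bar>G y - G z\<bar> \<le> \<epsilon>"
            using d1(2)[OF *(1,3)] d1(2)[OF *(2,4)] d2(2)[OF *(1,5)] d2(2)[OF *(2,6)]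
            unfolding dist_real_def by linarith+
        qed
        have "\<bar>\<Phi> v - \<Phi> u\<bar> = norm (integral {u..v} (\<lambda>\<tau>. (G v - G \<tau>) * f \<tau> + (F u - F \<tau>) * g \<tau>))"
          using inc[of u v] uv \<open>a \<le> u\<close> \<open>v \<le> b\<close> by (auto simp: integral_unique)
        also have "\<dots> \<le> integral {u..v} (\<lambda>\<tau>. \<epsilon> * ?m \<tau>)"
        proof (rule integral_norm_bound_integral)
          show "(\<lambda>\<tau>. (G v - G \<tau>) * f \<tau> + (F u - F \<tau>) * g \<tau>) integrable_on {u..v}"
            using inc[of u v] uv \<open>a \<le> u\<close> \<open>v \<le> b\<close> by auto
          show "(\<lambda>\<tau>. \<epsilon> * ?m \<tau>) integrable_on {u..v}"
            using uv \<open>a \<le> u\<close> \<open>v \<le> b\<close>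
            by (intro integrable_on_mult_right integrable_on_subinterval[OF m]) auto
          fix \<tau> assume "\<tau> \<in> {u..v}"
          then have "\<bar>G v - G \<tau>\<bar> * \<bar>f \<tau>\<bar> \<le> \<epsilon> * \<bar>f \<tau>\<bar>" "\<bar>F u - F \<tau>\<bar> * \<bar>g \<tau>\<bar> \<le> \<epsilon> * \<bar>g \<tau>\<bar>"
            using FG uv by (auto intro!: mult_right_mono)
          then show "norm ((G v - G \<tau>) * f \<tau> + (F u - F \<tau>) * g \<tau>) \<le> \<epsilon> * ?m \<tau>"
            unfolding real_norm_def distrib_left
            by (intro order_trans[OF abs_triangle_ineq]) (simp add: abs_mult)
        qed
        finally show "\<bar>\<Phi> v - \<Phi> u\<bar> \<le> \<epsilon> * integral {u..v} ?m" by simp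
      qed
    qed
    then show ?thesis using that by (simp add: P_def)
  qed
  have "F t * G t = F a * G a + integral {a..t} ?h" if t: "t \<in> {a..b}" for t
  proof -
    have mt: "0 \<le> integral {a..t} ?m"
      by (rule integral_nonneg) (use t in \<open>auto intro!: integrable_on_subinterval[OF m]\<close>)
    have "\<bar>\<Phi> t - \<Phi> a\<bar> \<le> 0 + e" if "e > 0" for e
    proof -
      \<comment> \<open>The \<open>+ 1\<close> keeps the denominator positive when the integral of
        \<open>?m\<close> is \<open>0\<close>.\<close>
      have "\<bar>\<Phi> t - \<Phi> a\<bar> \<le> e / (integral {a..t} ?m + 1) * integral {a..t} ?m"
        using that mt t by (intro small) auto
      also have "\<dots> \<le> e" using that mt by (simp add: field_simps)
      finally show ?thesis by simp
    qed
    then have "\<bar>\<Phi> t - \<Phi> a\<bar> \<le> 0" by (rule field_le_epsilon)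
    then show ?thesis by (simp add: \<Phi>_def)
  qed
  with h show ?thesis unfolding has_L1_derivative_def by blast
qed

lemma has_L1_derivative_C1:
  assumes "\<And>t. t \<in> {a..b} \<Longrightarrow> (F has_real_derivative f t) (at t)" "continuous_on {a..b} f"
  shows "has_L1_derivative a b F f"
proof -
  have int: "(f has_integral F t - F a) {a..t}" if "t \<in> {a..b}" for t
    by (rule fundamental_theorem_of_calculus)
      (use that assms(1) in \<open>auto simp flip: has_real_derivative_iff_has_vector_derivative intro: has_field_derivative_at_within\<close>)
  have "F t = F a + integral {a..t} f" if "t \<in> {a..b}" for t
  proof -
    have "integral {a..t} f = F t - F a" by (rule integral_unique) (rule int[OF that])
    then show ?thesis by linarith
  qed
  then show ?thesis
    unfolding has_L1_derivative_def using absolutely_integrable_continuous_real[OF assms(2)] by blast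
qed

text \<open>Integrate the square of \<open>g - \<eta> / (2 (t - T))\<close>; the cross term is the derivative of
  \<open>\<eta>\<^sup>2 / (2 (t - T))\<close>, up to \<open>\<eta>\<^sup>2 / (2 (t - T)\<^sup>2)\<close>.\<close>

lemma hardy_inequality:
  fixes \<eta> g :: "real \<Rightarrow> real"
  assumes "a \<le> b" "T \<notin> {a..b}" and \<eta>: "has_L1_derivative a b \<eta> g"
    and g2: "(\<lambda>t. (g t)\<^sup>2) integrable_on {a..b}" and "\<eta> a = 0" "\<eta> b = 0"
  shows "integral {a..b} (\<lambda>t. (\<eta> t)\<^sup>2 / (t - T)\<^sup>2) / 4 \<le> integral {a..b} (\<lambda>t. (g t)\<^sup>2)"
proof -
  have ne: "t - T \<noteq> 0" if "t \<in> {a..b}" for t using that assms(2) by auto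
  have c\<eta>: "continuous_on {a..b} \<eta>" using \<eta> by (rule has_L1_derivative_continuous_on)
  let ?F = "\<lambda>t. \<eta> t * \<eta> t * (1 / (t - T) / 2)"
  let ?f = "\<lambda>t. 1 / (t - T) / 2 * (\<eta> t * g t + \<eta> t * g t) + \<eta> t * \<eta> t * (- 1 / (t - T)\<^sup>2 / 2)"
  have "has_L1_derivative a b (\<lambda>t. 1 / (t - T) / 2) (\<lambda>t. - 1 / (t - T)\<^sup>2 / 2)"
  proof (rule has_L1_derivative_C1)
    show "((\<lambda>t. 1 / (t - T) / 2) has_real_derivative - 1 / (t - T)\<^sup>2 / 2) (at t)" if "t \<in> {a..b}" for t
      using ne[OF that] by (auto intro!: derivative_eq_intros simp: power2_eq_square divide_simps) (simp add: algebra_simps)?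
    show "continuous_on {a..b} (\<lambda>t. - 1 / (t - T)\<^sup>2 / 2)"
      using ne by (intro continuous_intros) auto
  qed
  from has_L1_derivative_mult[OF has_L1_derivative_mult[OF \<eta> \<eta>] this]
  have "has_L1_derivative a b ?F ?f" .
  \<comment> \<open>\<open>\<eta>\<close> vanishes at both ends, so the exact derivative integrates
    to \<open>0\<close>.\<close>
  from has_L1_derivative_increment[OF this, of a b] assms
  have 1: "(?f has_integral 0) {a..b}" by simp
  have "(\<lambda>t. (\<eta> t)\<^sup>2 / (t - T)\<^sup>2) integrable_on {a..b}"
    using ne by (intro integrable_continuous_interval continuous_intros c\<eta>) auto
  then have 2: "((\<lambda>t. (\<eta> t)\<^sup>2 / (t - T)\<^sup>2) has_integral integral {a..b} (\<lambda>t. (\<eta> t)\<^sup>2 / (t - T)\<^sup>2)) {a..b}"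
    by (simp add: has_integral_iff)
  have 3: "((\<lambda>t. (g t)\<^sup>2) has_integral integral {a..b} (\<lambda>t. (g t)\<^sup>2)) {a..b}"
    using g2 by (simp add: has_integral_iff)
  let ?q = "\<lambda>t. (g t)\<^sup>2 - ?f t - ((\<eta> t)\<^sup>2 / (t - T)\<^sup>2) / 4"
  have "(?q has_integral integral {a..b} (\<lambda>t. (g t)\<^sup>2) - 0 - integral {a..b} (\<lambda>t. (\<eta> t)\<^sup>2 / (t - T)\<^sup>2) / 4) {a..b}"
    by (intro has_integral_diff has_integral_divide 1 2 3)
  moreover have "0 \<le> ?q t" if "t \<in> {a..b}" for t
  proof -
    have "?q t = (g t - \<eta> t / (t - T) / 2)\<^sup>2"
      unfolding divide_inverse power_inverse[symmetric] by (simp add: algebra_simps power2_eq_square)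
    then show ?thesis by simp
  qed
  ultimately have "0 \<le> integral {a..b} (\<lambda>t. (g t)\<^sup>2) - 0 - integral {a..b} (\<lambda>t. (\<eta> t)\<^sup>2 / (t - T)\<^sup>2) / 4"
    by (rule has_integral_nonneg)
  then show ?thesis by simp
qed

section \<open>The potential near a ray\<close>

lemma inner_circle_point: "circle_point u \<bullet> circle_point v = cos (u - v)"
  by (simp add: circle_point_def inner_vec_def sum_2 cos_diff)

lemma norm_circle_point [simp]: "norm (circle_point u) = 1"
  by (simp add: norm_eq_sqrt_inner inner_circle_point)

lemma circle_point_frame:
  "p = (p \<bullet> circle_point u) *\<^sub>R circle_point u + (p \<bullet> circle_point (u + pi/2)) *\<^sub>R circle_point (u + pi/2)"
proof -
  have e: "p \<bullet> circle_point u = p $ 1 * cos u + p $ 2 * sin u"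
    "p \<bullet> circle_point (u + pi/2) = p $ 2 * cos u - p $ 1 * sin u"
    by (simp_all add: circle_point_def inner_vec_def sum_2 sin_add cos_add)
  have z: "cos u * (cos u * z) + sin u * (sin u * z) = z" for z
  proof -
    have "cos u * (cos u * z) + sin u * (sin u * z) = (cos u * cos u + sin u * sin u) * z"
      by (simp only: distrib_right mult.assoc)
    then show ?thesis by (simp only: sin_cos_squared_add3 mult_1)
  qed
  show ?thesis
    unfolding vec_eq_iff forall_2 e
    by (simp add: circle_point_def sin_add cos_add algebra_simps) (simp only: z simp_thms)
qed

lemma circle_point_frame_inner:
  "p \<bullet> q = (p \<bullet> circle_point u) * (q \<bullet> circle_point u)
     + (p \<bullet> circle_point (u + pi/2)) * (q \<bullet> circle_point (u + pi/2))"
proof -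
  have "p \<bullet> q = ((p \<bullet> circle_point u) *\<^sub>R circle_point u
      + (p \<bullet> circle_point (u + pi/2)) *\<^sub>R circle_point (u + pi/2)) \<bullet> q"
    using circle_point_frame[of p u] by simp
  then show ?thesis
    by (simp only: inner_add_left inner_scaleR_left inner_commute[of "circle_point _" q])
qed

lemma circle_point_frame_norm:
  "(norm p)\<^sup>2 = (p \<bullet> circle_point u)\<^sup>2 + (p \<bullet> circle_point (u + pi/2))\<^sup>2"
  unfolding power2_norm_eq_inner circle_point_frame_inner[of p p u] by (simp add: power2_eq_square)

lemma circle_point_add:
  "circle_point (u + w) = cos w *\<^sub>R circle_point u + sin w *\<^sub>R circle_point (u + pi/2)"
  by (simp add: vec_eq_iff forall_2 circle_point_def sin_add cos_add)

text \<open>On the open half plane around the ray, the angle measured from the ray is the arctangent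
  of the slope. Regularity of \<open>\<UU>\<close> is given only in the angle, so this is the form
  of the potential that can be differentiated.\<close>

lemma potential_polar:
  assumes "0 < p \<bullet> circle_point \<theta>"
  shows "potential \<alpha> \<UU> p = angular \<UU> (\<theta> + arctan ((p \<bullet> circle_point (\<theta> + pi/2)) / (p \<bullet> circle_point \<theta>)))
    * ((p \<bullet> circle_point \<theta>)\<^sup>2 + (p \<bullet> circle_point (\<theta> + pi/2))\<^sup>2) powr (- \<alpha> / 2)"
proof -
  define X Y where XY: "X = p \<bullet> circle_point \<theta>" "Y = p \<bullet> circle_point (\<theta> + pi/2)"
  have X: "X > 0" using assms by (simp add: XY)
  have n: "norm p = sqrt (X\<^sup>2 + Y\<^sup>2)"
    unfolding XY circle_point_frame_norm[symmetric] by simp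
  have pos: "X\<^sup>2 + Y\<^sup>2 > 0" using X by (simp add: add_pos_nonneg)
  have "1 + (Y / X)\<^sup>2 = (X\<^sup>2 + Y\<^sup>2) / X\<^sup>2"
    using X by (simp add: power_divide add_divide_distrib)
  then have q: "sqrt (1 + (Y / X)\<^sup>2) = norm p / X"
    using X by (simp add: n real_sqrt_divide)
  have "circle_point (\<theta> + arctan (Y / X))
      = (X / norm p) *\<^sub>R circle_point \<theta> + (Y / norm p) *\<^sub>R circle_point (\<theta> + pi/2)"
    unfolding circle_point_add[of \<theta> "arctan (Y / X)"] cos_arctan sin_arctan q using X by simp
  also have "\<dots> = inverse (norm p) *\<^sub>R (X *\<^sub>R circle_point \<theta> + Y *\<^sub>R circle_point (\<theta> + pi/2))"
    unfolding scaleR_add_right scaleR_scaleR divide_inverse_commute by (rule refl)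
  also have "\<dots> = p /\<^sub>R norm p"
    unfolding XY circle_point_frame[of p \<theta>, symmetric] by (rule refl)
  finally have 1: "p /\<^sub>R norm p = circle_point (\<theta> + arctan (Y / X))" ..
  have "norm p = (X\<^sup>2 + Y\<^sup>2) powr (1/2)" using n pos by (simp add: powr_half_sqrt)
  then have "norm p powr \<alpha> = (X\<^sup>2 + Y\<^sup>2) powr (\<alpha> / 2)" by (simp add: powr_powr)
  then have "1 / norm p powr \<alpha> = (X\<^sup>2 + Y\<^sup>2) powr (- \<alpha> / 2)"
    by (simp add: powr_minus_divide)
  then have "potential \<alpha> \<UU> p = angular \<UU> (\<theta> + arctan (Y / X)) * (X\<^sup>2 + Y\<^sup>2) powr (- \<alpha> / 2)"
    unfolding potential_def 1 angular_def by (metis times_divide_eq_right mult.right_neutral)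
  then show ?thesis by (simp add: XY)
qed

section \<open>The potential along straight lines near the ray\<close>

lemma C2_real_DERIV:
  assumes "C2_real f"
  shows "(f has_real_derivative deriv f t) (at t)"
    and "(deriv f has_real_derivative deriv (deriv f) t) (at t)"
  using assms by (auto simp: C2_real_def DERIV_deriv_iff_real_differentiable)

lemma C2_real_continuous:
  assumes "C2_real f"
  shows "continuous_on UNIV f" "continuous_on UNIV (deriv f)" "continuous_on UNIV (deriv (deriv f))"
  using assms C2_real_DERIV[OF assms]
  by (auto simp: C2_real_def intro!: DERIV_continuous_on intro: has_field_derivative_at_within)

text \<open>In coordinates adapted to the ray at angle \<open>\<theta>\<close>, these are the values of the potential at
  \<open>(\<rho> + s \<xi>, s \<eta>)\<close> and its first two derivatives in \<open>s\<close>; \<open>f\<close> is the angular part.\<close>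

definition radius2 :: "real \<Rightarrow> real \<Rightarrow> real \<Rightarrow> real \<Rightarrow> real" where
  "radius2 \<rho> \<xi> \<eta> s = (\<rho> + s * \<xi>)\<^sup>2 + (s * \<eta>)\<^sup>2"

definition radius2' :: "real \<Rightarrow> real \<Rightarrow> real \<Rightarrow> real \<Rightarrow> real" where
  "radius2' \<rho> \<xi> \<eta> s = 2 * (\<xi> * (\<rho> + s * \<xi>) + s * \<eta>\<^sup>2)"

definition angle :: "real \<Rightarrow> real \<Rightarrow> real \<Rightarrow> real \<Rightarrow> real \<Rightarrow> real" where
  "angle \<theta> \<rho> \<xi> \<eta> s = \<theta> + arctan (s * \<eta> / (\<rho> + s * \<xi>))"

definition pot :: "real \<Rightarrow> (real \<Rightarrow> real) \<Rightarrow> real \<Rightarrow> real \<Rightarrow> real \<Rightarrow> real \<Rightarrow> real \<Rightarrow> real" where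
  "pot \<alpha> f \<theta> \<rho> \<xi> \<eta> s = f (angle \<theta> \<rho> \<xi> \<eta> s) * radius2 \<rho> \<xi> \<eta> s powr (- \<alpha> / 2)"

definition pot' :: "real \<Rightarrow> (real \<Rightarrow> real) \<Rightarrow> real \<Rightarrow> real \<Rightarrow> real \<Rightarrow> real \<Rightarrow> real \<Rightarrow> real" where
  "pot' \<alpha> f \<theta> \<rho> \<xi> \<eta> s =
     (deriv f (angle \<theta> \<rho> \<xi> \<eta> s) * (\<eta> * \<rho>) - \<alpha> / 2 * f (angle \<theta> \<rho> \<xi> \<eta> s) * radius2' \<rho> \<xi> \<eta> s)
     * radius2 \<rho> \<xi> \<eta> s powr (- \<alpha> / 2 - 1)"

definition pot'' :: "real \<Rightarrow> (real \<Rightarrow> real) \<Rightarrow> real \<Rightarrow> real \<Rightarrow> real \<Rightarrow> real \<Rightarrow> real \<Rightarrow> real" where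
  "pot'' \<alpha> f \<theta> \<rho> \<xi> \<eta> s =
     (deriv (deriv f) (angle \<theta> \<rho> \<xi> \<eta> s) * (\<eta> * \<rho>)\<^sup>2 / radius2 \<rho> \<xi> \<eta> s
       - \<alpha> / 2 * (deriv f (angle \<theta> \<rho> \<xi> \<eta> s) * (\<eta> * \<rho>) / radius2 \<rho> \<xi> \<eta> s * radius2' \<rho> \<xi> \<eta> s
           + f (angle \<theta> \<rho> \<xi> \<eta> s) * (2 * (\<xi>\<^sup>2 + \<eta>\<^sup>2))))
     * radius2 \<rho> \<xi> \<eta> s powr (- \<alpha> / 2 - 1)
     + (deriv f (angle \<theta> \<rho> \<xi> \<eta> s) * (\<eta> * \<rho>) - \<alpha> / 2 * f (angle \<theta> \<rho> \<xi> \<eta> s) * radius2' \<rho> \<xi> \<eta> s)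
     * ((- \<alpha> / 2 - 1) * radius2' \<rho> \<xi> \<eta> s * radius2 \<rho> \<xi> \<eta> s powr (- \<alpha> / 2 - 2))"

lemma radius2_pos: "0 < \<rho> + s * \<xi> \<Longrightarrow> 0 < radius2 \<rho> \<xi> \<eta> s"
  by (simp add: radius2_def add_pos_nonneg)

lemma radius2_DERIV: "(radius2 \<rho> \<xi> \<eta> has_real_derivative radius2' \<rho> \<xi> \<eta> s) (at s)"
  unfolding radius2_def[abs_def] radius2'_def
  by (auto intro!: derivative_eq_intros simp: power2_eq_square algebra_simps)

lemma radius2'_DERIV: "(radius2' \<rho> \<xi> \<eta> has_real_derivative 2 * (\<xi>\<^sup>2 + \<eta>\<^sup>2)) (at s)"
  unfolding radius2'_def[abs_def]
  by (auto intro!: derivative_eq_intros simp: power2_eq_square algebra_simps)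

text \<open>The numerator is the angular momentum of the uniform motion
  \<open>(\<rho> + s \<xi>, s \<eta>)\<close>, hence constantly \<open>\<eta> \<rho>\<close>. This
  is the origin of the factor \<open>\<eta> * \<rho>\<close> in \<open>pot'\<close> and
  \<open>pot''\<close>.\<close>

lemma angle_DERIV:
  assumes "0 < \<rho> + s * \<xi>"
  shows "(angle \<theta> \<rho> \<xi> \<eta> has_real_derivative \<eta> * \<rho> / radius2 \<rho> \<xi> \<eta> s) (at s)"
proof -
  let ?d = "\<rho> + s * \<xi>"
  have "((\<lambda>s. s * \<eta> / (\<rho> + s * \<xi>)) has_real_derivative (\<eta> * ?d - s * \<eta> * \<xi>) / (?d * ?d)) (at s)"
    using assms by (auto intro!: derivative_eq_intros)
  from DERIV_add[OF DERIV_const[of \<theta>] DERIV_chain2[OF DERIV_arctan this]]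
  have "(angle \<theta> \<rho> \<xi> \<eta> has_real_derivative
      inverse (1 + (s * \<eta> / ?d)\<^sup>2) * ((\<eta> * ?d - s * \<eta> * \<xi>) / (?d * ?d))) (at s)"
    unfolding angle_def[abs_def] by simp
  moreover have "inverse (1 + (s * \<eta> / ?d)\<^sup>2) = ?d\<^sup>2 / radius2 \<rho> \<xi> \<eta> s"
  proof -
    have "1 + (s * \<eta> / ?d)\<^sup>2 = radius2 \<rho> \<xi> \<eta> s / ?d\<^sup>2"
      using assms by (simp add: radius2_def power_divide add_divide_distrib)
    then show ?thesis by simp
  qed
  moreover have "?d\<^sup>2 / radius2 \<rho> \<xi> \<eta> s * ((\<eta> * ?d - s * \<eta> * \<xi>) / (?d * ?d)) = \<eta> * \<rho> / radius2 \<rho> \<xi> \<eta> s"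
  proof -
    have "\<eta> * ?d - s * \<eta> * \<xi> = \<eta> * \<rho>" by (simp add: algebra_simps)
    then show ?thesis using assms by (simp add: power2_eq_square)
  qed
  ultimately show ?thesis by metis
qed

lemma radius2_powr_DERIV:
  assumes "0 < \<rho> + s * \<xi>"
  shows "((\<lambda>s. radius2 \<rho> \<xi> \<eta> s powr c) has_real_derivative
      c * radius2' \<rho> \<xi> \<eta> s * radius2 \<rho> \<xi> \<eta> s powr (c - 1)) (at s)"
  using DERIV_chain2[OF has_real_derivative_powr[OF radius2_pos[OF assms]] radius2_DERIV]
  by (simp add: mult_ac)

lemma pot_DERIV:
  assumes "C2_real f" and s: "0 < \<rho> + s * \<xi>"
  shows "(pot \<alpha> f \<theta> \<rho> \<xi> \<eta> has_real_derivative pot' \<alpha> f \<theta> \<rho> \<xi> \<eta> s) (at s)"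
proof -
  let ?K = "radius2 \<rho> \<xi> \<eta> s" and ?A = "angle \<theta> \<rho> \<xi> \<eta> s"
  have K: "?K > 0" using s by (rule radius2_pos)
  have p: "?K powr (- \<alpha> / 2) = ?K powr (- \<alpha> / 2 - 1) * ?K"
    using K by (simp add: powr_diff)
  have "(pot \<alpha> f \<theta> \<rho> \<xi> \<eta> has_real_derivative
      deriv f ?A * (\<eta> * \<rho> / ?K) * ?K powr (- \<alpha> / 2)
      + - \<alpha> / 2 * radius2' \<rho> \<xi> \<eta> s * ?K powr (- \<alpha> / 2 - 1) * f ?A) (at s)"
    unfolding pot_def[abs_def]
    by (intro DERIV_mult DERIV_chain2[OF C2_real_DERIV(1)[OF assms(1)] angle_DERIV[OF s]]
        radius2_powr_DERIV[OF s])
  moreover have "deriv f ?A * (\<eta> * \<rho> / ?K) * ?K powr (- \<alpha> / 2) = deriv f ?A * (\<eta> * \<rho>) * ?K powr (- \<alpha> / 2 - 1)"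
    using K unfolding p by simp
  ultimately show ?thesis
    unfolding pot'_def by (simp only: left_diff_distrib) (simp add: mult_ac)
qed

lemma pot'_DERIV:
  assumes "C2_real f" and s: "0 < \<rho> + s * \<xi>"
  shows "(pot' \<alpha> f \<theta> \<rho> \<xi> \<eta> has_real_derivative pot'' \<alpha> f \<theta> \<rho> \<xi> \<eta> s) (at s)"
proof -
  let ?K = "radius2 \<rho> \<xi> \<eta> s" and ?A = "angle \<theta> \<rho> \<xi> \<eta> s" and ?K' = "radius2' \<rho> \<xi> \<eta> s"
  have e: "- \<alpha> / 2 - 1 - 1 = - \<alpha> / 2 - 2" by simp
  note d = C2_real_DERIV[OF assms(1)] and A = angle_DERIV[OF s]
  have "((\<lambda>s. deriv f (angle \<theta> \<rho> \<xi> \<eta> s) * (\<eta> * \<rho>) - \<alpha> / 2 * (f (angle \<theta> \<rho> \<xi> \<eta> s) * radius2' \<rho> \<xi> \<eta> s))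
     has_real_derivative deriv (deriv f) ?A * (\<eta> * \<rho> / ?K) * (\<eta> * \<rho>)
       - \<alpha> / 2 * (deriv f ?A * (\<eta> * \<rho> / ?K) * ?K' + 2 * (\<xi>\<^sup>2 + \<eta>\<^sup>2) * f ?A)) (at s)"
    by (intro DERIV_diff DERIV_cmult DERIV_cmult_right DERIV_mult DERIV_chain2[OF d(1) A]
        DERIV_chain2[OF d(2) A] radius2'_DERIV)
  from DERIV_mult[OF this radius2_powr_DERIV[OF s, where c = "- \<alpha> / 2 - 1"]]
  show ?thesis unfolding pot'_def[abs_def] pot''_def
    by (rule back_subst[of "\<lambda>F. (F has_real_derivative _) _", OF DERIV_cong])
      (simp_all only: e, simp_all add: power2_eq_square mult_ac)
qed

text \<open>Criticality of \<open>\<theta>\<close> removes the mixed term in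
  \<open>\<xi> \<eta>\<close>, so the radial and angular directions decouple. The radial entry comes
  from differentiating \<open>\<rho> powr (- \<alpha>)\<close> twice. The summand
  \<open>- \<alpha> * f \<theta>\<close> of the angular entry is there because a tangential
  displacement increases the distance to the origin to second order.\<close>

lemma pot''_at_ray:
  assumes "deriv f \<theta> = 0" "0 < \<rho>"
  shows "pot'' \<alpha> f \<theta> \<rho> \<xi> \<eta> 0 =
    \<rho> powr (- \<alpha> - 2) * (\<alpha> * (\<alpha> + 1) * f \<theta> * \<xi>\<^sup>2 + (deriv (deriv f) \<theta> - \<alpha> * f \<theta>) * \<eta>\<^sup>2)"
proof -
  have p: "(\<rho>\<^sup>2) powr c = \<rho> powr (2 * c)" for c
    using assms(2) powr_powr[of \<rho> 2 c] by simp
  have q: "\<rho> powr (- \<alpha> - 2) = \<rho> powr (- \<alpha> - 4) * \<rho>\<^sup>2"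
  proof -
    have "\<rho> powr (- \<alpha> - 2) = \<rho> powr ((- \<alpha> - 4) + 2)"
      by (rule arg_cong[of _ _ "(powr) \<rho>"]) simp
    also have "\<dots> = \<rho> powr (- \<alpha> - 4) * \<rho> powr 2" by (rule powr_add)
    finally show ?thesis using assms(2) by simp
  qed
  have e: "2 * (- \<alpha> / 2 - 1) = - \<alpha> - 2" "2 * (- \<alpha> / 2 - 2) = - \<alpha> - 4" by simp_all
  have "pot'' \<alpha> f \<theta> \<rho> \<xi> \<eta> 0 =
      (deriv (deriv f) \<theta> * \<eta>\<^sup>2 - \<alpha> * f \<theta> * (\<xi>\<^sup>2 + \<eta>\<^sup>2)) * \<rho> powr (- \<alpha> - 2)
      + \<alpha> * (\<alpha> + 2) * f \<theta> * \<xi>\<^sup>2 * (\<rho> powr (- \<alpha> - 4) * \<rho>\<^sup>2)"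
  proof -
    have r: "radius2 \<rho> \<xi> \<eta> 0 = \<rho>\<^sup>2" "radius2' \<rho> \<xi> \<eta> 0 = 2 * \<xi> * \<rho>" "angle \<theta> \<rho> \<xi> \<eta> 0 = \<theta>"
      by (simp_all add: radius2_def radius2'_def angle_def)
    show ?thesis
      using assms(2) unfolding pot''_def r p e assms(1)
      by (simp add: power_mult_distrib) (simp add: power2_eq_square algebra_simps)
  qed
  then show ?thesis unfolding q[symmetric] by (simp add: algebra_simps)
qed

lemma continuous_on_compose_UNIV:
  "continuous_on UNIV f \<Longrightarrow> continuous_on S g \<Longrightarrow> continuous_on S (\<lambda>x. f (g x))"
  by (rule continuous_on_compose2) auto

text \<open>The parameters range over an arbitrary space so that one statement covers both a fixed
  \<open>s\<close> on \<open>{a..b}\<close>, for integrability, and the product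
  \<open>D \<times> {a..b}\<close>, for the joint continuity that differentiation under the integral
  asks for.\<close>

lemma continuous_on_pot:
  fixes S :: "'a::topological_space set"
  assumes f: "C2_real f" and c: "continuous_on S \<rho>" "continuous_on S \<xi>" "continuous_on S \<eta>" "continuous_on S \<sigma>"
    and pos: "\<And>z. z \<in> S \<Longrightarrow> 0 < \<rho> z + \<sigma> z * \<xi> z"
  shows "continuous_on S (\<lambda>z. pot \<alpha> f \<theta> (\<rho> z) (\<xi> z) (\<eta> z) (\<sigma> z))"
    "continuous_on S (\<lambda>z. pot' \<alpha> f \<theta> (\<rho> z) (\<xi> z) (\<eta> z) (\<sigma> z))"
    "continuous_on S (\<lambda>z. pot'' \<alpha> f \<theta> (\<rho> z) (\<xi> z) (\<eta> z) (\<sigma> z))"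
proof -
  have ne: "\<rho> z + \<sigma> z * \<xi> z \<noteq> 0" "radius2 (\<rho> z) (\<xi> z) (\<eta> z) (\<sigma> z) \<noteq> 0" if "z \<in> S" for z
    using pos[OF that] radius2_pos[OF pos[OF that], of "\<eta> z"] by auto
  have A: "continuous_on S (\<lambda>z. angle \<theta> (\<rho> z) (\<xi> z) (\<eta> z) (\<sigma> z))"
    unfolding angle_def using ne by (intro continuous_intros c) auto
  have K: "continuous_on S (\<lambda>z. radius2 (\<rho> z) (\<xi> z) (\<eta> z) (\<sigma> z))"
    unfolding radius2_def by (intro continuous_intros c)
  have K': "continuous_on S (\<lambda>z. radius2' (\<rho> z) (\<xi> z) (\<eta> z) (\<sigma> z))"
    unfolding radius2'_def by (intro continuous_intros c)
  note F = C2_real_continuous[OF f, THEN continuous_on_compose_UNIV, OF A]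
  show "continuous_on S (\<lambda>z. pot \<alpha> f \<theta> (\<rho> z) (\<xi> z) (\<eta> z) (\<sigma> z))"
    "continuous_on S (\<lambda>z. pot' \<alpha> f \<theta> (\<rho> z) (\<xi> z) (\<eta> z) (\<sigma> z))"
    "continuous_on S (\<lambda>z. pot'' \<alpha> f \<theta> (\<rho> z) (\<xi> z) (\<eta> z) (\<sigma> z))"
    unfolding pot_def pot'_def pot''_def using ne
    by (auto intro!: continuous_on_add continuous_on_diff continuous_on_mult continuous_on_divide
        continuous_on_powr continuous_on_power continuous_on_const c A K K' F)
qed

lemma potential_eq_pot:
  assumes "0 < \<rho> + s * (h \<bullet> circle_point \<theta>)"
  shows "potential \<alpha> \<UU> (\<rho> *\<^sub>R circle_point \<theta> + s *\<^sub>R h) =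
    pot \<alpha> (angular \<UU>) \<theta> \<rho> (h \<bullet> circle_point \<theta>) (h \<bullet> circle_point (\<theta> + pi/2)) s"
proof -
  let ?p = "\<rho> *\<^sub>R circle_point \<theta> + s *\<^sub>R h"
  have "?p \<bullet> circle_point \<theta> = \<rho> + s * (h \<bullet> circle_point \<theta>)"
    "?p \<bullet> circle_point (\<theta> + pi/2) = s * (h \<bullet> circle_point (\<theta> + pi/2))"
    by (simp_all add: inner_add_left inner_circle_point)
  then show ?thesis
    using potential_polar[of ?p \<theta> \<alpha> \<UU>] assms by (simp add: pot_def angle_def radius2_def)
qed

section \<open>The second variation\<close>

lemma has_L2_derivative_integrable:
  assumes "has_L2_derivative a b y g"
  shows "g integrable_on {a..b}" "(\<lambda>t. (norm (g t))\<^sup>2) integrable_on {a..b}"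
  using assms unfolding has_L2_derivative_def
  by (blast intro: set_lebesgue_integral_eq_integral(1))+

lemma has_L2_derivative_unique:
  assumes 1: "has_L2_derivative a b y g" and 2: "has_L2_derivative a b y g'"
  obtains N where "negligible N" "\<And>t. t \<in> {a..b} - N \<Longrightarrow> g t = g' t"
proof -
  have i: "g integrable_on {a..b}" "g' integrable_on {a..b}"
    by (rule has_L2_derivative_integrable(1), fact)+
  have "integral {a..t} (\<lambda>t. g t - g' t) = 0" if t: "t \<in> {a..b}" for t
  proof -
    have "{a..t} \<subseteq> {a..b}" using t by auto
    then have "g integrable_on {a..t}" "g' integrable_on {a..t}"
      using i by (auto intro: integrable_on_subinterval)
    then have "integral {a..t} (\<lambda>t. g t - g' t) = integral {a..t} g - integral {a..t} g'"
      by (rule integral_diff)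
    moreover have "y t = y a + integral {a..t} g" "y t = y a + integral {a..t} g'"
      using 1 2 t unfolding has_L2_derivative_def by blast+
    ultimately show ?thesis by (metis add_left_imp_eq right_minus_eq)
  qed
  then obtain N where "negligible N" "\<And>t. t \<in> {a..b} - N \<Longrightarrow> g t - g' t = 0"
    using indefinite_integral_zero_imp_ae_zero[OF integrable_diff[OF i]] by metis
  then show ?thesis using that[of N] by simp
qed

lemma absolutely_integrable_inner_continuous:
  fixes v g :: "real \<Rightarrow> 'a::euclidean_space"
  assumes "continuous_on {a..b} v" "g absolutely_integrable_on {a..b}"
  shows "(\<lambda>t. v t \<bullet> g t) absolutely_integrable_on {a..b}"
proof (rule absolutely_integrable_bounded_measurable_product[where h = inner and f = v])
  show "bilinear (inner :: 'a \<Rightarrow> 'a \<Rightarrow> real)"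
    using bilinear_conv_bounded_bilinear bounded_bilinear_inner by blast
  show "v \<in> borel_measurable (lebesgue_on {a..b})"
    using assms(1) by (rule continuous_imp_measurable_on_sets_lebesgue) simp
  show "bounded (v ` {a..b})"
    using assms(1) by (intro compact_imp_bounded compact_continuous_image compact_Icc)
qed (use assms(2) in simp_all)

lemma norm_add_scaled_power2:
  fixes v g :: "'a::real_inner"
  shows "(norm (v + s *\<^sub>R g))\<^sup>2 = (norm v)\<^sup>2 + 2 * s * (v \<bullet> g) + s\<^sup>2 * (norm g)\<^sup>2"
  unfolding power2_norm_eq_inner
  by (simp add: inner_add_left inner_add_right inner_commute power2_eq_square algebra_simps)

text \<open>The cross term \<open>v t \<bullet> g t\<close> of the squared norm is integrable
  because \<open>v\<close> is continuous, hence bounded on \<open>{a..b}\<close>.\<close>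

lemma has_L2_derivative_add_scaled:
  assumes x: "has_L2_derivative a b x v" and v: "continuous_on {a..b} v"
    and h: "has_L2_derivative a b h g"
  shows "has_L2_derivative a b (\<lambda>t. x t + s *\<^sub>R h t) (\<lambda>t. v t + s *\<^sub>R g t)"
  unfolding has_L2_derivative_def
proof (intro conjI ballI)
  have va: "v absolutely_integrable_on {a..b}" and ga: "g absolutely_integrable_on {a..b}"
    using x h unfolding has_L2_derivative_def by blast+
  then show "(\<lambda>t. v t + s *\<^sub>R g t) absolutely_integrable_on {a..b}"
    by (intro set_integral_add absolutely_integrable_scaleR_left)
  have "(\<lambda>t. (norm (v t))\<^sup>2) absolutely_integrable_on {a..b}"
    "(\<lambda>t. (norm (g t))\<^sup>2) absolutely_integrable_on {a..b}"
    using x h unfolding has_L2_derivative_def by blast+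
  moreover have "(\<lambda>t. v t \<bullet> g t) absolutely_integrable_on {a..b}"
    using v ga by (rule absolutely_integrable_inner_continuous)
  ultimately show "(\<lambda>t. (norm (v t + s *\<^sub>R g t))\<^sup>2) absolutely_integrable_on {a..b}"
    unfolding norm_add_scaled_power2
    by (intro set_integral_add set_integrable_mult_right)
  fix t assume t: "t \<in> {a..b}"
  then have "{a..t} \<subseteq> {a..b}" by auto
  then have "v integrable_on {a..t}" "g integrable_on {a..t}"
    using has_L2_derivative_integrable(1)[OF x] has_L2_derivative_integrable(1)[OF h]
    by (auto intro: integrable_on_subinterval)
  then have e: "integral {a..t} (\<lambda>t. v t + s *\<^sub>R g t) = integral {a..t} v + s *\<^sub>R integral {a..t} g"
    by (simp add: integral_add integrable_cmul)
  have xh: "x t = x a + integral {a..t} v" "h t = h a + integral {a..t} g"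
    using x h t unfolding has_L2_derivative_def by blast+
  show "x t + s *\<^sub>R h t = x a + s *\<^sub>R h a + integral {a..t} (\<lambda>t. v t + s *\<^sub>R g t)"
    unfolding e xh by (simp add: scaleR_add_right)
qed

lemma has_L2_derivative_weak_derivative:
  assumes "has_L2_derivative a b y g"
  shows "has_L2_derivative a b y (weak_derivative a b y)"
  using assms unfolding weak_derivative_def by (rule someI[of "has_L2_derivative a b y"])

text \<open>\<open>weak_derivative\<close> is an unspecified choice, but any two admissible
  derivatives agree almost everywhere, so the action can be computed with an explicit one.\<close>

lemma action_eq:
  assumes y: "has_L2_derivative a b y g"
  shows "action U a b y = integral {a..b} (\<lambda>t. 1/2 * (norm (g t))\<^sup>2 + U (y t))"
proof -
  obtain N where N: "negligible N" "\<And>t. t \<in> {a..b} - N \<Longrightarrow> g t = weak_derivative a b y t"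
    using has_L2_derivative_unique[OF y has_L2_derivative_weak_derivative[OF y]] by blast
  show ?thesis
    unfolding action_def by (rule integral_spike[OF N(1)]) (simp add: N(2))
qed

lemma continuous_on_apply_bcontfun: "continuous_on S (apply_bcontfun h)"
  using apply_bcontfun[of h] by (auto simp: bcontfun_def intro: continuous_on_subset)

text \<open>The kinetic part of the action of \<open>x + s h\<close> is exactly a quadratic
  polynomial in \<open>s\<close>, however irregular \<open>g\<close> is. Only the potential part is
  differentiated under the integral. It involves \<open>h\<close> but not \<open>g\<close>, so its
  integrand is continuous jointly in \<open>s\<close> and \<open>t\<close>.\<close>

lemma d2_action_eq:
  assumes \<UU>: "C2_circle \<UU>" and crit: "deriv (angular \<UU>) \<theta> = 0"
    and x: "has_L2_derivative a b (\<lambda>t. r t *\<^sub>R circle_point \<theta>) v" and v: "continuous_on {a..b} v"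
    and r: "continuous_on {a..b} r" and rpos: "\<And>t. t \<in> {a..b} \<Longrightarrow> 0 < r t"
    and h: "has_L2_derivative a b (apply_bcontfun h) g"
    and xr: "\<And>t. t \<in> {a..b} \<Longrightarrow> x t = r t *\<^sub>R circle_point \<theta>"
  defines "u\<^sub>0 \<equiv> angular \<UU> \<theta>" and "u\<^sub>2 \<equiv> deriv (deriv (angular \<UU>)) \<theta>"
  shows "d2_action (potential \<alpha> \<UU>) x a b h = integral {a..b} (\<lambda>t. (norm (g t))\<^sup>2)
    + integral {a..b} (\<lambda>t. r t powr (- \<alpha> - 2) *
       (\<alpha> * (\<alpha> + 1) * u\<^sub>0 * (apply_bcontfun h t \<bullet> circle_point \<theta>)\<^sup>2
        + (u\<^sub>2 - \<alpha> * u\<^sub>0) * (apply_bcontfun h t \<bullet> circle_point (\<theta> + pi/2))\<^sup>2))"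
proof -
  define f where "f = angular \<UU>"
  have f: "C2_real f" using \<UU> by (simp add: f_def C2_circle_def)
  define \<xi> where "\<xi> t = apply_bcontfun h t \<bullet> circle_point \<theta>" for t
  define \<eta> where "\<eta> t = apply_bcontfun h t \<bullet> circle_point (\<theta> + pi/2)" for t
  have \<xi>: "continuous_on S \<xi>" and \<eta>: "continuous_on S \<eta>" for S
    unfolding \<xi>_def \<eta>_def by (intro continuous_intros continuous_on_apply_bcontfun)+
  obtain m where m: "m > 0" "\<And>t. t \<in> {a..b} \<Longrightarrow> m \<le> r t"
  proof (cases "{a..b} = {}")
    case True then show ?thesis using that[of 1] by simp
  next
    case False
    with continuous_attains_inf[OF compact_Icc False r] obtain t0 where
      "t0 \<in> {a..b}" "\<forall>t\<in>{a..b}. r t0 \<le> r t" by blast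
    then show ?thesis using that rpos by blast
  qed
  have "bounded (\<xi> ` {a..b})"
    by (intro compact_imp_bounded compact_continuous_image compact_Icc \<xi>)
  then obtain M where M: "M > 0" "\<And>t. t \<in> {a..b} \<Longrightarrow> \<bar>\<xi> t\<bar> \<le> M"
    unfolding bounded_pos by auto
  \<comment> \<open>\<open>m\<close> bounds the distance of the orbit to the origin from below and
    \<open>M\<close> bounds the radial perturbation, so \<open>\<bar>s\<bar> < m / M\<close> keeps
    the perturbed curve inside the half plane of the ray.\<close>
  define \<delta> where "\<delta> = m / M"
  define D where "D = {-\<delta><..<\<delta>}"
  have \<delta>: "\<delta> > 0" using m M by (simp add: \<delta>_def)
  then have D: "open D" "convex D" "0 \<in> D" by (auto simp: D_def)
  have pos: "0 < r t + s * \<xi> t" if "s \<in> D" "t \<in> {a..b}" for s t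
  proof -
    have "\<bar>s * \<xi> t\<bar> < m"
    proof -
      have "\<bar>s\<bar> * \<bar>\<xi> t\<bar> \<le> \<bar>s\<bar> * M" using M(2)[OF that(2)] by (intro mult_left_mono) auto
      also have "\<dots> < \<delta> * M" using that M by (intro mult_strict_right_mono) (auto simp: D_def)
      also have "\<dots> = m" using M by (simp add: \<delta>_def)
      finally show ?thesis by (simp add: abs_mult)
    qed
    with m(2)[OF that(2)] show ?thesis by linarith
  qed
  define P where "P s t = pot \<alpha> f \<theta> (r t) (\<xi> t) (\<eta> t) s" for s t
  define P' where "P' s t = pot' \<alpha> f \<theta> (r t) (\<xi> t) (\<eta> t) s" for s t
  define P'' where "P'' s t = pot'' \<alpha> f \<theta> (r t) (\<xi> t) (\<eta> t) s" for s t
  have cP: "continuous_on (D \<times> {a..b}) (\<lambda>(s, t). P' s t)" "continuous_on (D \<times> {a..b}) (\<lambda>(s, t). P'' s t)"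
    unfolding P'_def P''_def split_beta
    by (rule continuous_on_pot[OF f]; use pos in \<open>force intro!: continuous_intros
        continuous_on_compose2[OF r] continuous_on_compose2[OF \<xi>] continuous_on_compose2[OF \<eta>]\<close>)+
  have iP: "P s integrable_on {a..b}" "P' s integrable_on {a..b}" if "s \<in> D" for s
    unfolding P_def P'_def
    by (rule integrable_continuous_interval, rule continuous_on_pot[OF f];
        use pos[OF that] in \<open>auto intro!: r \<xi> \<eta> continuous_intros\<close>)+
  have dP: "((\<lambda>s. integral {a..b} (P s)) has_real_derivative integral {a..b} (P' s)) (at s)"
    and dP': "((\<lambda>s. integral {a..b} (P' s)) has_real_derivative integral {a..b} (P'' s)) (at s)"
    if "s \<in> D" for s
  proof -
    have "((\<lambda>s. P s t) has_real_derivative P' s t) (at s within D)"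
      "((\<lambda>s. P' s t) has_real_derivative P'' s t) (at s within D)" if "s \<in> D" "t \<in> {a..b}" for s t
      using pot_DERIV[OF f pos[OF that]] pot'_DERIV[OF f pos[OF that]]
      unfolding P_def P'_def P''_def by (auto intro: has_field_derivative_at_within)
    from leibniz_rule_field_derivative[of D a b P P' s, unfolded cbox_interval, OF this(1) iP(1) cP(1) \<open>s \<in> D\<close> D(2)]
      leibniz_rule_field_derivative[of D a b P' P'' s, unfolded cbox_interval, OF this(2) iP(2) cP(2) \<open>s \<in> D\<close> D(2)]
    show "((\<lambda>s. integral {a..b} (P s)) has_real_derivative integral {a..b} (P' s)) (at s)"
      "((\<lambda>s. integral {a..b} (P' s)) has_real_derivative integral {a..b} (P'' s)) (at s)"
      using at_within_open[OF \<open>s \<in> D\<close> D(1)] by auto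
  qed
  define c0 where "c0 = integral {a..b} (\<lambda>t. (norm (v t))\<^sup>2)"
  define c1 where "c1 = integral {a..b} (\<lambda>t. v t \<bullet> g t)"
  define c2 where "c2 = integral {a..b} (\<lambda>t. (norm (g t))\<^sup>2)"
  have A: "action (potential \<alpha> \<UU>) a b (\<lambda>t. x t + s *\<^sub>R apply_bcontfun h t)
      = c0 / 2 + c1 * s + c2 / 2 * s\<^sup>2 + integral {a..b} (P s)" if "s \<in> D" for s
  proof -
    have "action (potential \<alpha> \<UU>) a b (\<lambda>t. x t + s *\<^sub>R apply_bcontfun h t) =
        integral {a..b} (\<lambda>t. 1/2 * (norm (v t + s *\<^sub>R g t))\<^sup>2
          + potential \<alpha> \<UU> (x t + s *\<^sub>R apply_bcontfun h t))"
    proof (rule action_eq)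
      have "has_L2_derivative a b x v"
      proof (cases "a \<le> b")
        case True
        then have "a \<in> {a..b}" by simp
        with x show ?thesis unfolding has_L2_derivative_def using xr by metis
      qed (use x in \<open>simp add: has_L2_derivative_def\<close>)
      then show "has_L2_derivative a b (\<lambda>t. x t + s *\<^sub>R apply_bcontfun h t) (\<lambda>t. v t + s *\<^sub>R g t)"
        using v h by (rule has_L2_derivative_add_scaled)
    qed
    also have "\<dots> = integral {a..b} (\<lambda>t. 1/2 * (norm (v t))\<^sup>2 + s * (v t \<bullet> g t) + s\<^sup>2 / 2 * (norm (g t))\<^sup>2 + P s t)"
    proof (rule integral_cong)
      fix t assume "t \<in> {a..b}"
      from potential_eq_pot[OF pos[OF \<open>s \<in> D\<close> this, unfolded \<xi>_def], of \<alpha> \<UU>] xr[OF this]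
      have "potential \<alpha> \<UU> (x t + s *\<^sub>R apply_bcontfun h t) = P s t"
        by (simp add: P_def f_def \<xi>_def \<eta>_def)
      then show "1/2 * (norm (v t + s *\<^sub>R g t))\<^sup>2 + potential \<alpha> \<UU> (x t + s *\<^sub>R apply_bcontfun h t)
        = 1/2 * (norm (v t))\<^sup>2 + s * (v t \<bullet> g t) + s\<^sup>2 / 2 * (norm (g t))\<^sup>2 + P s t"
        by (simp add: norm_add_scaled_power2)
    qed
    also have "\<dots> = 1/2 * c0 + s * c1 + s\<^sup>2 / 2 * c2 + integral {a..b} (P s)"
    proof (rule integral_unique, intro has_integral_add has_integral_mult_right)
      show "((\<lambda>t. (norm (v t))\<^sup>2) has_integral c0) {a..b}" "((\<lambda>t. (norm (g t))\<^sup>2) has_integral c2) {a..b}"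
        using has_L2_derivative_integrable(2)[OF x] has_L2_derivative_integrable(2)[OF h]
        by (simp_all add: c0_def c2_def has_integral_integral)
      have "(\<lambda>t. v t \<bullet> g t) absolutely_integrable_on {a..b}"
        using h v unfolding has_L2_derivative_def by (intro absolutely_integrable_inner_continuous) blast+
      from set_lebesgue_integral_eq_integral(1)[OF this]
      show "((\<lambda>t. v t \<bullet> g t) has_integral c1) {a..b}"
        by (simp add: c1_def has_integral_integral)
      show "(P s has_integral integral {a..b} (P s)) {a..b}"
        using iP(1)[OF \<open>s \<in> D\<close>] by (simp add: has_integral_integral)
    qed
    finally show ?thesis by simp
  qed
  \<comment> \<open>The outer \<open>deriv\<close> acts on the function given by the inner one, so
    the first derivative has to be identified on the whole neighbourhood \<open>D\<close> and not
    only at \<open>0\<close>.\<close>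
  have 1: "deriv (\<lambda>s. action (potential \<alpha> \<UU>) a b (\<lambda>t. x t + s *\<^sub>R apply_bcontfun h t)) s
      = c1 + c2 * s + integral {a..b} (P' s)" if "s \<in> D" for s
  proof (rule DERIV_imp_deriv)
    have "((\<lambda>s. c0 / 2 + c1 * s + c2 / 2 * s\<^sup>2 + integral {a..b} (P s)) has_real_derivative
        c1 + c2 * s + integral {a..b} (P' s)) (at s)"
      by (auto intro!: derivative_eq_intros dP[OF that])
    then show "((\<lambda>s. action (potential \<alpha> \<UU>) a b (\<lambda>t. x t + s *\<^sub>R apply_bcontfun h t)) has_real_derivative
        c1 + c2 * s + integral {a..b} (P' s)) (at s)"
      by (rule has_field_derivative_transform_within_open[OF _ D(1) that]) (simp add: A)
  qed
  have "d2_action (potential \<alpha> \<UU>) x a b h = c2 + integral {a..b} (P'' 0)"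
    unfolding d2_action_def
  proof (rule DERIV_imp_deriv)
    have "((\<lambda>s. c1 + c2 * s + integral {a..b} (P' s)) has_real_derivative
        c2 + integral {a..b} (P'' 0)) (at 0)"
      by (auto intro!: derivative_eq_intros dP'[OF D(3)])
    then show "(deriv (\<lambda>s. action (potential \<alpha> \<UU>) a b (\<lambda>t. x t + s *\<^sub>R apply_bcontfun h t))
        has_real_derivative c2 + integral {a..b} (P'' 0)) (at 0)"
      by (rule has_field_derivative_transform_within_open[OF _ D(1,3)]) (simp add: 1)
  qed
  also have "integral {a..b} (P'' 0) = integral {a..b} (\<lambda>t. r t powr (- \<alpha> - 2) *
       (\<alpha> * (\<alpha> + 1) * u\<^sub>0 * (\<xi> t)\<^sup>2 + (u\<^sub>2 - \<alpha> * u\<^sub>0) * (\<eta> t)\<^sup>2))"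
    using crit rpos unfolding P''_def
    by (intro integral_cong) (simp add: pot''_at_ray f_def u\<^sub>0_def u\<^sub>2_def)
  finally show ?thesis unfolding c2_def \<xi>_def \<eta>_def .
qed

section \<open>Homothetic zero energy motions\<close>

text \<open>At a critical angle the angular factor of the polar formula has zero gradient, so only
  the power of the distance contributes and the force points along the ray.\<close>

lemma GDERIV_potential_ray:
  assumes "C2_circle \<UU>" "deriv (angular \<UU>) \<theta> = 0" and \<rho>: "0 < \<rho>"
  shows "GDERIV (potential \<alpha> \<UU>) (\<rho> *\<^sub>R circle_point \<theta>) :>
    (- \<alpha> * angular \<UU> \<theta> * \<rho> powr (- \<alpha> - 1)) *\<^sub>R circle_point \<theta>"
proof -
  define e0 e1 where e: "e0 = circle_point \<theta>" "e1 = circle_point (\<theta> + pi/2)"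
  let ?p = "\<rho> *\<^sub>R e0"
  have ee: "e0 \<bullet> e0 = 1" "e0 \<bullet> e1 = 0" by (simp_all add: e inner_circle_point)
  then have p: "?p \<bullet> e0 = \<rho>" "?p \<bullet> e1 = 0" by simp_all
  have lin: "GDERIV (\<lambda>p. p \<bullet> e) q :> e" for e q :: "real^2"
    unfolding gderiv_def by (rule bounded_linear_imp_has_derivative) (rule bounded_linear_inner_left)
  have "(?p \<bullet> e0) \<noteq> 0" using \<rho> ee by simp
  \<comment> \<open>The gradient of the angle is carried along as an unspecified \<open>d\<close>:
    the chain rule multiplies it by the derivative of \<open>angular \<UU>\<close> at
    \<open>\<theta>\<close>, which is \<open>0\<close>.\<close>
  from GDERIV_mult[OF lin GDERIV_inverse[OF lin this]]
  obtain d where "GDERIV (\<lambda>p. (p \<bullet> e1) * inverse (p \<bullet> e0)) ?p :> d" by blast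
  from GDERIV_DERIV_compose[OF this DERIV_arctan]
  obtain d where "GDERIV (\<lambda>p. arctan ((p \<bullet> e1) * inverse (p \<bullet> e0))) ?p :> d" by blast
  from GDERIV_add[OF GDERIV_const[of \<theta>] this]
  obtain d where d: "GDERIV (\<lambda>p. \<theta> + arctan ((p \<bullet> e1) * inverse (p \<bullet> e0))) ?p :> d" by blast
  have "(angular \<UU> has_real_derivative 0) (at (\<theta> + arctan ((?p \<bullet> e1) * inverse (?p \<bullet> e0))))"
    unfolding p using C2_real_DERIV(1)[of "angular \<UU>" \<theta>] assms(1,2) by (simp add: C2_circle_def)
  from GDERIV_DERIV_compose[OF d this]
  have 1: "GDERIV (\<lambda>p. angular \<UU> (\<theta> + arctan ((p \<bullet> e1) * inverse (p \<bullet> e0)))) ?p :> 0" by simp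
  have 2: "GDERIV (\<lambda>p. (p \<bullet> e0) * (p \<bullet> e0) + (p \<bullet> e1) * (p \<bullet> e1)) ?p :> (2 * \<rho>) *\<^sub>R e0"
    by (rule GDERIV_subst[OF GDERIV_add[OF GDERIV_mult[OF lin lin] GDERIV_mult[OF lin lin]]])
      (simp add: ee flip: scaleR_add_left)
  have "0 < (?p \<bullet> e0) * (?p \<bullet> e0) + (?p \<bullet> e1) * (?p \<bullet> e1)" using \<rho> by (simp add: ee)
  from GDERIV_DERIV_compose[OF 2 has_real_derivative_powr[OF this, of "- \<alpha> / 2"]]
  have 3: "GDERIV (\<lambda>p. ((p \<bullet> e0) * (p \<bullet> e0) + (p \<bullet> e1) * (p \<bullet> e1)) powr (- \<alpha> / 2)) ?p :>
      (- \<alpha> / 2 * (\<rho> * \<rho>) powr (- \<alpha> / 2 - 1)) *\<^sub>R (2 * \<rho>) *\<^sub>R e0"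
    by (simp add: ee)
  have pw: "(\<rho> * \<rho>) powr c = \<rho> powr (2 * c)" for c
    using \<rho> by (simp add: powr_mult flip: powr_add)
  have "\<rho> powr (2 * (- \<alpha> / 2 - 1)) * \<rho> = \<rho> powr (2 * (- \<alpha> / 2 - 1) + 1)"
    using \<rho> by (simp only: powr_add powr_one[OF order_less_imp_le])
  also have "2 * (- \<alpha> / 2 - 1) + 1 = - \<alpha> - 1" by simp
  finally have pw1: "\<rho> powr (2 * (- \<alpha> / 2 - 1)) * \<rho> = \<rho> powr (- \<alpha> - 1)" .
  have "(- \<alpha> / 2 * (\<rho> * \<rho>) powr (- \<alpha> / 2 - 1)) *\<^sub>R (2 * \<rho>) *\<^sub>R e0 = (- \<alpha> * \<rho> powr (- \<alpha> - 1)) *\<^sub>R e0"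
    unfolding pw pw1[symmetric] by simp
  with 3 have 3: "GDERIV (\<lambda>p. ((p \<bullet> e0) * (p \<bullet> e0) + (p \<bullet> e1) * (p \<bullet> e1)) powr (- \<alpha> / 2)) ?p :>
      (- \<alpha> * \<rho> powr (- \<alpha> - 1)) *\<^sub>R e0" by metis
  from GDERIV_mult[OF 1 3]
  have 4: "GDERIV (\<lambda>p. angular \<UU> (\<theta> + arctan ((p \<bullet> e1) * inverse (p \<bullet> e0)))
      * ((p \<bullet> e0) * (p \<bullet> e0) + (p \<bullet> e1) * (p \<bullet> e1)) powr (- \<alpha> / 2)) ?p :>
      (- \<alpha> * angular \<UU> \<theta> * \<rho> powr (- \<alpha> - 1)) *\<^sub>R e0"
    by (simp add: ee mult_ac)
  have "open {p. 0 < p \<bullet> e0}" by (intro open_Collect_less continuous_intros)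
  with 4 have "GDERIV (potential \<alpha> \<UU>) ?p :> (- \<alpha> * angular \<UU> \<theta> * \<rho> powr (- \<alpha> - 1)) *\<^sub>R e0"
    unfolding gderiv_def
  proof (rule has_derivative_transform_within_open)
    show "?p \<in> {p. 0 < p \<bullet> e0}" using \<rho> ee by simp
    show "angular \<UU> (\<theta> + arctan ((q \<bullet> e1) * inverse (q \<bullet> e0)))
      * ((q \<bullet> e0) * (q \<bullet> e0) + (q \<bullet> e1) * (q \<bullet> e1)) powr (- \<alpha> / 2) = potential \<alpha> \<UU> q"
      if "q \<in> {p. 0 < p \<bullet> e0}" for q
      using potential_polar[of q \<theta> \<alpha> \<UU>] that
      by (simp add: e divide_inverse[of "q \<bullet> _"] power2_eq_square)
  qed
  then show ?thesis by (simp add: e)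
qed

lemma potential_ray:
  assumes "0 < \<rho>"
  shows "potential \<alpha> \<UU> (\<rho> *\<^sub>R circle_point \<theta>) = angular \<UU> \<theta> * \<rho> powr (- \<alpha>)"
  using assms by (simp add: potential_def angular_def powr_minus_divide)

lemma has_vector_derivative_scaleR_const:
  "(f has_real_derivative f') (at t) \<Longrightarrow> ((\<lambda>t. f t *\<^sub>R e) has_vector_derivative f' *\<^sub>R e) (at t)"
  using has_vector_derivative_scaleR[of f f' t UNIV "\<lambda>_. e" 0] by simp

text \<open>This explicit motion is the candidate extension to be played against maximality. It
  leaves the collision for \<open>\<sigma> = 1\<close> and falls into it for
  \<open>\<sigma> = -1\<close>. Exponent and constant come from zero energy, which forces the power
  \<open>(\<alpha> + 2) / 2\<close> of the radius to have constant speed \<open>k\<close>.\<close>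

lemma parabolic_ray_solution:
  assumes \<alpha>: "0 < \<alpha>" and \<UU>: "C2_circle \<UU>" "deriv (angular \<UU>) \<theta> = 0" and u: "0 < angular \<UU> \<theta>"
    and S: "Sm < Sp" "\<And>t. t \<in> einterval Sm Sp \<Longrightarrow> 0 < \<sigma> * (t - T)" and \<sigma>: "\<sigma> * \<sigma> = 1"
  defines "k \<equiv> (\<alpha> + 2) / 2 * sqrt (2 * angular \<UU> \<theta>)"
  shows "solution_on (potential \<alpha> \<UU>)
    (\<lambda>t. (k * (\<sigma> * (t - T))) powr (2 / (\<alpha> + 2)) *\<^sub>R circle_point \<theta>) Sm Sp"
  unfolding solution_on_def
proof (intro conjI exI ballI)
  let ?e = "circle_point \<theta>" and ?\<beta> = "2 / (\<alpha> + 2)"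
  let ?z = "\<lambda>t. k * (\<sigma> * (t - T))"
  have k: "k > 0" using \<alpha> u by (simp add: k_def)
  fix t assume "t \<in> einterval Sm Sp"
  then have z: "0 < ?z t" using S(2) k by simp
  have dz: "(?z has_real_derivative k * \<sigma>) (at t)"
    by (auto intro!: derivative_eq_intros)
  have dp: "((\<lambda>t. ?z t powr c) has_real_derivative c * ?z t powr (c - 1) * (k * \<sigma>)) (at t)" for c
    by (rule DERIV_chain2[OF has_real_derivative_powr[OF z] dz])
  show "?z t powr ?\<beta> *\<^sub>R ?e \<noteq> 0"
    using z norm_circle_point[of \<theta>] by (metis less_irrefl norm_zero powr_gt_zero scaleR_eq_0_iff zero_neq_one)
  show "((\<lambda>t. ?z t powr ?\<beta> *\<^sub>R ?e) has_vector_derivative (?\<beta> * ?z t powr (?\<beta> - 1) * (k * \<sigma>)) *\<^sub>R ?e) (at t)"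
    by (rule has_vector_derivative_scaleR_const) (rule dp)
  have "0 < ?z t powr ?\<beta>" using z by (metis less_irrefl powr_gt_zero)
  from GDERIV_potential_ray[OF \<UU> this]
  show "GDERIV (potential \<alpha> \<UU>) (?z t powr ?\<beta> *\<^sub>R ?e) :>
     (- \<alpha> * angular \<UU> \<theta> * (?z t powr ?\<beta>) powr (- \<alpha> - 1)) *\<^sub>R ?e" .
  have "((\<lambda>t. ?\<beta> * ?z t powr (?\<beta> - 1) * (k * \<sigma>)) has_real_derivative
      ?\<beta> * ((?\<beta> - 1) * ?z t powr (?\<beta> - 1 - 1) * (k * \<sigma>)) * (k * \<sigma>)) (at t)"
    by (intro DERIV_cmult DERIV_cmult_right dp)
  moreover have "?\<beta> * ((?\<beta> - 1) * ?z t powr (?\<beta> - 1 - 1) * (k * \<sigma>)) * (k * \<sigma>)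
      = - \<alpha> * angular \<UU> \<theta> * (?z t powr ?\<beta>) powr (- \<alpha> - 1)"
  proof -
    have b1: "?\<beta> - 1 = - \<alpha> / (\<alpha> + 2)" using \<alpha> by (simp add: field_simps)
    \<comment> \<open>Newton's equation for the power law reduces to this identity between
      coefficients: multiplied by \<open>angular \<UU> \<theta>\<close>, it says that
      \<open>?\<beta> * (?\<beta> - 1) * k^2\<close> is the coefficient of the force.\<close>
    have b: "?\<beta> * (?\<beta> - 1) * ((\<alpha> + 2) / 2)\<^sup>2 * 2 = - \<alpha>"
      using \<alpha> unfolding b1 by (simp add: power2_eq_square)
    have "?\<beta> - 1 - 1 = ?\<beta> * (- \<alpha> - 1)"
      using \<alpha> by (simp add: field_simps)
    then have "(?z t powr ?\<beta>) powr (- \<alpha> - 1) = ?z t powr (?\<beta> - 1 - 1)"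
      by (simp add: powr_powr)
    moreover have "k * k = ((\<alpha> + 2) / 2)\<^sup>2 * 2 * angular \<UU> \<theta>"
      using u by (simp add: k_def power2_eq_square)
    then have "?\<beta> * (?\<beta> - 1) * (k * k) = - \<alpha> * angular \<UU> \<theta>"
      unfolding b[symmetric] by (simp add: mult_ac)
    moreover have "?\<beta> * ((?\<beta> - 1) * z * (k * \<sigma>)) * (k * \<sigma>) = ?\<beta> * (?\<beta> - 1) * (k * k) * (\<sigma> * \<sigma>) * z" for z
      by (simp only: mult_ac)
    ultimately show ?thesis by (simp only: \<sigma> mult_1_right)
  qed
  ultimately show "((\<lambda>t. (?\<beta> * ?z t powr (?\<beta> - 1) * (k * \<sigma>)) *\<^sub>R ?e) has_vector_derivative
     (- \<alpha> * angular \<UU> \<theta> * (?z t powr ?\<beta>) powr (- \<alpha> - 1)) *\<^sub>R ?e) (at t)"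
    by (intro has_vector_derivative_scaleR_const) (simp only:)
qed (use S in simp)

lemma constant_sign:
  fixes w :: "real \<Rightarrow> real"
  assumes "connected I" "continuous_on I w" "\<And>t. t \<in> I \<Longrightarrow> w t \<noteq> 0"
  obtains \<sigma> :: real where "\<sigma> = 1 \<or> \<sigma> = -1" "\<And>t. t \<in> I \<Longrightarrow> \<bar>w t\<bar> = \<sigma> * w t"
proof -
  have "connected (w ` I)" using assms(2,1) by (rule connected_continuous_image)
  have "(\<forall>t\<in>I. 0 < w t) \<or> (\<forall>t\<in>I. w t < 0)"
  proof (rule ccontr)
    assume "\<not> ?thesis"
    then obtain s t where st: "s \<in> I" "\<not> 0 < w s" "t \<in> I" "\<not> w t < 0" by blast
    then have "w s \<le> 0" "0 \<le> w t" by auto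
    with \<open>connected (w ` I)\<close> st have "0 \<in> w ` I"
      using connectedD_interval[of "w ` I" "w s" "w t" 0] by blast
    with assms(3) show False by force
  qed
  then show ?thesis
  proof
    assume "\<forall>t\<in>I. 0 < w t" then show ?thesis by (intro that[of 1]) auto
  next
    assume "\<forall>t\<in>I. w t < 0" then show ?thesis by (intro that[of "-1"]) auto
  qed
qed

text \<open>On the ray, zero energy reads \<open>r'^2 = 2 u r^(-\<alpha>)\<close> with
  \<open>u = angular \<UU> \<theta> > 0\<close>. So \<open>r'\<close> never vanishes and keeps its
  sign \<open>\<sigma>\<close> on the interval. Separation of variables then makes
  \<open>r^((\<alpha> + 2) / 2)\<close> affine with slope \<open>k * \<sigma>\<close>; the zero of
  that affine function is \<open>T\<close>.\<close>

lemma homothetic_zero_energy: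
  assumes \<alpha>: "0 < \<alpha>" and u: "0 < angular \<UU> \<theta>"
    and sol: "solution_on (potential \<alpha> \<UU>) x Tm Tp" and en: "zero_energy (potential \<alpha> \<UU>) x Tm Tp"
    and r: "\<And>t. t \<in> einterval Tm Tp \<Longrightarrow> 0 < r t \<and> x t = r t *\<^sub>R circle_point \<theta>"
  defines "k \<equiv> (\<alpha> + 2) / 2 * sqrt (2 * angular \<UU> \<theta>)"
  obtains v \<sigma> T where "\<And>t. t \<in> einterval Tm Tp \<Longrightarrow> (x has_vector_derivative v t) (at t)"
    "continuous_on (einterval Tm Tp) v" "continuous_on (einterval Tm Tp) r"
    "\<sigma> = 1 \<or> \<sigma> = -1"
    "\<And>t. t \<in> einterval Tm Tp \<Longrightarrow> r t powr ((\<alpha> + 2) / 2) = k * (\<sigma> * (t - T))"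
proof -
  let ?I = "einterval Tm Tp" and ?e = "circle_point \<theta>"
  obtain v where v: "\<And>t. t \<in> ?I \<Longrightarrow> (x has_vector_derivative v t) (at t)"
    and v': "\<And>t. t \<in> ?I \<Longrightarrow> \<exists>a. (v has_vector_derivative a) (at t)"
    using sol unfolding solution_on_def by blast
  have cv: "continuous_on ?I v"
    using v' has_vector_derivative_continuous by (blast intro: continuous_at_imp_continuous_on)
  define w where "w t = v t \<bullet> ?e" for t
  have cw: "continuous_on ?I w" unfolding w_def by (intro continuous_intros cv)
  have dr: "(r has_real_derivative w t) (at t)" if "t \<in> ?I" for t
  proof -
    have "((\<lambda>t. x t \<bullet> ?e) has_vector_derivative w t) (at t)"
      unfolding w_def by (rule bounded_linear.has_vector_derivative[OF bounded_linear_inner_left v[OF that]])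
    then have "(r has_vector_derivative w t) (at t)"
      by (rule has_vector_derivative_transform_within_open[OF _ open_einterval that])
        (simp add: r inner_circle_point)
    then show ?thesis by (simp add: has_real_derivative_iff_has_vector_derivative)
  qed
  have cr: "continuous_on ?I r"
    using dr DERIV_isCont by (blast intro: continuous_at_imp_continuous_on)
  have w2: "(w t)\<^sup>2 = 2 * angular \<UU> \<theta> * r t powr (- \<alpha>)" if t: "t \<in> ?I" for t
  proof -
    have "(x has_vector_derivative w t *\<^sub>R ?e) (at t)"
      using has_vector_derivative_scaleR_const[OF dr[OF t], of ?e] 
      by (rule has_vector_derivative_transform_within_open[OF _ open_einterval t]) (simp add: r)
    then have "vector_derivative x (at t) = w t *\<^sub>R ?e" by (rule vector_derivative_at)
    moreover have "1/2 * (norm (vector_derivative x (at t)))\<^sup>2 - potential \<alpha> \<UU> (x t) = 0"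
      using en t unfolding zero_energy_def by blast
    moreover have "potential \<alpha> \<UU> (x t) = angular \<UU> \<theta> * r t powr (- \<alpha>)"
      using r[OF t] potential_ray by metis
    ultimately show ?thesis by simp
  qed
  have w0: "w t \<noteq> 0" if "t \<in> ?I" for t
  proof -
    have "0 < (w t)\<^sup>2" unfolding w2[OF that] using u r[OF that] by simp
    then show ?thesis by auto
  qed
  have conv: "convex ?I"
    unfolding is_interval_convex_1[symmetric] is_interval_1 einterval_def mem_Collect_eq
    by (auto; metis ereal_less_eq(3) le_less_trans less_le_trans)
  obtain \<sigma> where \<sigma>: "\<sigma> = 1 \<or> \<sigma> = -1" "\<And>t. t \<in> ?I \<Longrightarrow> \<bar>w t\<bar> = \<sigma> * w t"
    using constant_sign[OF convex_connected[OF conv] cw w0] by metis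
  have k: "k > 0" using \<alpha> u by (simp add: k_def)
  have weq: "w t = \<sigma> * (sqrt (2 * angular \<UU> \<theta>) * r t powr (- \<alpha> / 2))" if t: "t \<in> ?I" for t
  proof -
    have rt: "r t > 0" using r t by blast
    have "(r t powr (- \<alpha> / 2))\<^sup>2 = r t powr (- \<alpha>)"
      using rt by (simp add: powr_power)
    then have "sqrt (r t powr (- \<alpha>)) = r t powr (- \<alpha> / 2)"
      by (metis powr_ge_zero real_sqrt_unique)
    then have "\<bar>w t\<bar> = sqrt (2 * angular \<UU> \<theta>) * r t powr (- \<alpha> / 2)"
      by (metis w2[OF t] real_sqrt_abs real_sqrt_mult)
    with \<sigma>(2)[OF t] have "\<sigma> * (\<sigma> * w t) = \<sigma> * (sqrt (2 * angular \<UU> \<theta>) * r t powr (- \<alpha> / 2))" by simp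
    then show ?thesis using \<sigma>(1) by auto
  qed
  have d0: "((\<lambda>t. r t powr ((\<alpha> + 2) / 2) - k * \<sigma> * t) has_real_derivative 0) (at t)" if t: "t \<in> ?I" for t
  proof -
    have rt: "r t > 0" using r t by blast
    have "((\<lambda>t. r t powr ((\<alpha> + 2) / 2)) has_real_derivative
        (\<alpha> + 2) / 2 * r t powr ((\<alpha> + 2) / 2 - 1) * w t) (at t)"
      by (rule DERIV_chain2[OF has_real_derivative_powr[OF rt] dr[OF t]])
    moreover have "(\<alpha> + 2) / 2 * r t powr ((\<alpha> + 2) / 2 - 1) * w t = k * \<sigma>"
    proof -
      have "(\<alpha> + 2) / 2 - 1 + - \<alpha> / 2 = 0" by (simp add: field_simps)
      then have "r t powr ((\<alpha> + 2) / 2 - 1) * r t powr (- \<alpha> / 2) = 1"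
        using rt by (metis powr_add powr_zero_eq_one less_irrefl)
      then have "(\<alpha> + 2) / 2 * (r t powr ((\<alpha> + 2) / 2 - 1) * r t powr (- \<alpha> / 2)) * sqrt (2 * angular \<UU> \<theta>) * \<sigma> = k * \<sigma>"
        by (simp add: k_def)
      then show ?thesis unfolding weq[OF t] by (simp only: mult_ac)
    qed
    ultimately have "((\<lambda>t. r t powr ((\<alpha> + 2) / 2)) has_real_derivative k * \<sigma>) (at t)"
      by (simp only:)
    from DERIV_diff[OF this DERIV_cmult_Id[of "k * \<sigma>"]] show ?thesis by simp
  qed
  obtain c where c: "\<And>t. t \<in> ?I \<Longrightarrow> r t powr ((\<alpha> + 2) / 2) - k * \<sigma> * t = c"
    using has_field_derivative_zero_constant[OF conv has_field_derivative_at_within[OF d0]] by metis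
  have "r t powr ((\<alpha> + 2) / 2) = k * (\<sigma> * (t - - c / (k * \<sigma>)))" if "t \<in> ?I" for t
  proof -
    have "k * (\<sigma> * (t - - c / (k * \<sigma>))) = k * \<sigma> * t + c"
      using k \<sigma>(1) by (auto simp: field_simps)
    then show ?thesis using c[OF that] by linarith
  qed
  then show ?thesis using that[OF v cv cr \<sigma>(1)] by blast
qed

text \<open>The explicit motion \<open>y\<close> agrees with \<open>x\<close> and solves the
  equation wherever \<open>\<sigma> * (t - T)\<close> is positive, so the domain of \<open>x\<close>
  must be that whole half line. The weight \<open>r^(- \<alpha> - 2)\<close> is the inverse square
  of \<open>r^((\<alpha> + 2) / 2)\<close>, and \<open>k^2 = (\<alpha> + 2)^2 * u / 2\<close>
  supplies its constant.\<close>

lemma homothetic_maximal_interval: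
  assumes \<alpha>: "0 < \<alpha>" and \<UU>: "C2_circle \<UU>" "deriv (angular \<UU>) \<theta> = 0" and u: "0 < angular \<UU> \<theta>"
    and max: "maximal_solution (potential \<alpha> \<UU>) x Tm Tp" and en: "zero_energy (potential \<alpha> \<UU>) x Tm Tp"
    and r: "\<And>t. t \<in> einterval Tm Tp \<Longrightarrow> 0 < r t \<and> x t = r t *\<^sub>R circle_point \<theta>"
  obtains v T where "\<And>t. t \<in> einterval Tm Tp \<Longrightarrow> (x has_vector_derivative v t) (at t)"
    "continuous_on (einterval Tm Tp) v" "continuous_on (einterval Tm Tp) r"
    "(Tm = ereal T \<and> Tp = \<infinity>) \<or> (Tm = -\<infinity> \<and> Tp = ereal T)"
    "\<And>t. t \<in> einterval Tm Tp \<Longrightarrow> r t powr (- \<alpha> - 2) = 2 / ((\<alpha> + 2)\<^sup>2 * angular \<UU> \<theta> * (t - T)\<^sup>2)"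
proof -
  define k where "k = (\<alpha> + 2) / 2 * sqrt (2 * angular \<UU> \<theta>)"
  have k: "k > 0" using \<alpha> u by (simp add: k_def)
  have sol: "solution_on (potential \<alpha> \<UU>) x Tm Tp" using max unfolding maximal_solution_def by blast
  then have lt: "Tm < Tp" unfolding solution_on_def by blast
  obtain v \<sigma> T where v: "\<And>t. t \<in> einterval Tm Tp \<Longrightarrow> (x has_vector_derivative v t) (at t)"
    "continuous_on (einterval Tm Tp) v" "continuous_on (einterval Tm Tp) r"
    and \<sigma>: "\<sigma> = 1 \<or> \<sigma> = -1"
    and q: "\<And>t. t \<in> einterval Tm Tp \<Longrightarrow> r t powr ((\<alpha> + 2) / 2) = k * (\<sigma> * (t - T))"
    using homothetic_zero_energy[OF \<alpha> u sol en r] unfolding k_def by metis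
  have pos: "0 < \<sigma> * (t - T)" if "t \<in> einterval Tm Tp" for t
  proof -
    have "0 < k * (\<sigma> * (t - T))" using q[OF that] r[OF that] by (metis less_irrefl powr_gt_zero)
    with k show ?thesis by (simp add: zero_less_mult_iff)
  qed
  define y where "y t = (k * (\<sigma> * (t - T))) powr (2 / (\<alpha> + 2)) *\<^sub>R circle_point \<theta>" for t
  have yx: "y t = x t" if "t \<in> einterval Tm Tp" for t
  proof -
    have "(r t powr ((\<alpha> + 2) / 2)) powr (2 / (\<alpha> + 2)) = r t"
    proof -
      have "(\<alpha> + 2) / 2 * (2 / (\<alpha> + 2)) = 1" using \<alpha> by simp
      then show ?thesis using r[OF that] by (simp only: powr_powr) simp
    qed
    then show ?thesis using r[OF that] by (simp add: y_def flip: q[OF that])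
  qed
  \<comment> \<open>Maximality enters here: any interval that contains the domain and on which
    \<open>\<sigma> * (t - T)\<close> stays positive carries the extension \<open>y\<close>, so it
    has the same endpoints.\<close>
  have ends: "Sm = Tm \<and> Sp = Tp" if "Sm \<le> Tm" "Tp \<le> Sp" "\<And>t. t \<in> einterval Sm Sp \<Longrightarrow> 0 < \<sigma> * (t - T)" for Sm Sp
  proof -
    have "Sm < Sp" using lt that(1,2) by (meson le_less_trans less_le_trans)
    moreover have "\<sigma> * \<sigma> = 1" using \<sigma> by auto
    ultimately have "solution_on (potential \<alpha> \<UU>) y Sm Sp"
      unfolding y_def k_def using parabolic_ray_solution[OF \<alpha> \<UU> u _ that(3)] by blast
    with max yx that(1,2) show ?thesis unfolding maximal_solution_def by blast
  qed
  have "(Tm = ereal T \<and> Tp = \<infinity>) \<or> (Tm = -\<infinity> \<and> Tp = ereal T)"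
    using \<sigma>
  proof
    assume 1: "\<sigma> = 1"
    \<comment> \<open>Otherwise the domain would contain times before \<open>T\<close>, where
      \<open>\<sigma> * (t - T)\<close> is negative.\<close>
    have "ereal T \<le> Tm"
    proof (rule ccontr)
      assume "\<not> ereal T \<le> Tm"
      then have "Tm < min (ereal T) Tp" using lt by simp
      then obtain t where "Tm < ereal t" "ereal t < min (ereal T) Tp" using ereal_dense2 by blast
      then show False using pos[of t] 1 by (simp add: einterval_iff)
    qed
    from ends[OF this, of \<infinity>] 1 show ?thesis by auto
  next
    assume 1: "\<sigma> = -1"
    have "Tp \<le> ereal T"
    proof (rule ccontr)
      assume "\<not> Tp \<le> ereal T"
      then have "max (ereal T) Tm < Tp" using lt by simp
      then obtain t where "max (ereal T) Tm < ereal t" "ereal t < Tp" using ereal_dense2 by blast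
      then show False using pos[of t] 1 by (simp add: einterval_iff)
    qed
    from ends[OF _ this, of "-\<infinity>"] 1 show ?thesis by auto
  qed
  moreover have "r t powr (- \<alpha> - 2) = 2 / ((\<alpha> + 2)\<^sup>2 * angular \<UU> \<theta> * (t - T)\<^sup>2)" if "t \<in> einterval Tm Tp" for t
  proof -
    have rt: "r t > 0" using r that by blast
    have e: "(\<alpha> + 2) / 2 + (\<alpha> + 2) / 2 = - (- \<alpha> - 2)" by (simp add: field_simps)
    have "r t powr ((\<alpha> + 2) / 2) * r t powr ((\<alpha> + 2) / 2) = r t powr (- (- \<alpha> - 2))"
      unfolding powr_add[symmetric] e ..
    moreover have "(k * (\<sigma> * (t - T))) * (k * (\<sigma> * (t - T))) = (k * k) * (\<sigma> * \<sigma>) * ((t - T) * (t - T))"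
      by (simp only: mult_ac)
    moreover have "\<sigma> * \<sigma> = 1" using \<sigma> by auto
    moreover have "k * k = (\<alpha> + 2)\<^sup>2 / 2 * angular \<UU> \<theta>"
      using u by (simp add: k_def power2_eq_square)
    ultimately have "r t powr (- (- \<alpha> - 2)) = (\<alpha> + 2)\<^sup>2 / 2 * angular \<UU> \<theta> * (t - T)\<^sup>2"
      unfolding q[OF that] by (simp add: power2_eq_square)
    then have "r t powr (- \<alpha> - 2) = inverse ((\<alpha> + 2)\<^sup>2 / 2 * angular \<UU> \<theta> * (t - T)\<^sup>2)"
      by (metis powr_minus inverse_inverse_eq)
    then show ?thesis by (simp add: inverse_eq_divide)
  qed
  ultimately show ?thesis using that[OF v] by blast
qed

section \<open>Bounds for the Morse index\<close>

lemma has_L2_derivative_inner: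
  assumes "has_L2_derivative a b y g"
  shows "has_L1_derivative a b (\<lambda>t. y t \<bullet> e) (\<lambda>t. g t \<bullet> e)"
    and "(\<lambda>t. (g t \<bullet> e)\<^sup>2) integrable_on {a..b}"
proof -
  have g: "g absolutely_integrable_on {a..b}"
    and y: "\<And>t. t \<in> {a..b} \<Longrightarrow> y t = y a + integral {a..t} g"
    using assms unfolding has_L2_derivative_def by blast+
  have ge: "(\<lambda>t. g t \<bullet> e) absolutely_integrable_on {a..b}"
    using absolutely_integrable_linear[OF g bounded_linear_inner_left[of e]] by (simp add: o_def)
  have "y t \<bullet> e = y a \<bullet> e + integral {a..t} (\<lambda>t. g t \<bullet> e)" if t: "t \<in> {a..b}" for t
  proof -
    have "{a..t} \<subseteq> {a..b}" using t by auto
    then have "g integrable_on {a..t}"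
      using has_L2_derivative_integrable(1)[OF assms] by (rule integrable_on_subinterval[rotated])
    from integral_linear[OF this bounded_linear_inner_left[of e]]
    have "integral {a..t} (\<lambda>t. g t \<bullet> e) = integral {a..t} g \<bullet> e" by (simp add: o_def)
    then show ?thesis unfolding y[OF t] by (simp add: inner_add_left)
  qed
  with ge show "has_L1_derivative a b (\<lambda>t. y t \<bullet> e) (\<lambda>t. g t \<bullet> e)"
    unfolding has_L1_derivative_def by blast
  have m: "(\<lambda>t. g t \<bullet> e) \<in> borel_measurable (lebesgue_on {a..b})"
    using set_lebesgue_integral_eq_integral(1)[OF ge] by (rule integrable_imp_measurable)
  have "(\<lambda>t. (norm e)\<^sup>2 * (norm (g t))\<^sup>2) integrable_on {a..b}"
    using has_L2_derivative_integrable(2)[OF assms] by (rule integrable_on_mult_right)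
  then have "(\<lambda>t. (g t \<bullet> e)\<^sup>2) absolutely_integrable_on {a..b}"
  proof (rule measurable_bounded_by_integrable_imp_absolutely_integrable[rotated 2])
    show "(\<lambda>t. (g t \<bullet> e)\<^sup>2) \<in> borel_measurable (lebesgue_on {a..b})"
      using m by (rule borel_measurable_power)
    show "norm ((g t \<bullet> e)\<^sup>2) \<le> (norm e)\<^sup>2 * (norm (g t))\<^sup>2" for t
      using power_mono[OF Cauchy_Schwarz_ineq2[of "g t" e], of 2]
      by (simp add: power_mult_distrib mult.commute)
  qed simp
  then show "(\<lambda>t. (g t \<bullet> e)\<^sup>2) integrable_on {a..b}"
    by (rule set_lebesgue_integral_eq_integral(1))
qed

text \<open>The second variation along a parabolic homothetic motion, in coordinates adapted to its ray;
  \<open>T\<close> is the collision time.\<close>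

definition inverse_square_variation ::
    "(real^2 \<Rightarrow> real) \<Rightarrow> (real \<Rightarrow> real^2) \<Rightarrow> real \<Rightarrow> real \<Rightarrow> real \<Rightarrow> real \<Rightarrow> real \<Rightarrow> real \<Rightarrow> bool" where
  "inverse_square_variation U x \<theta> T A \<beta> a b \<longleftrightarrow>
     (\<forall>h g. has_L2_derivative a b (apply_bcontfun h) g \<longrightarrow>
        d2_action U x a b h = integral {a..b} (\<lambda>t. (norm (g t))\<^sup>2) + integral {a..b} (\<lambda>t.
          (A * (apply_bcontfun h t \<bullet> circle_point \<theta>)\<^sup>2
           + \<beta> * (apply_bcontfun h t \<bullet> circle_point (\<theta> + pi/2))\<^sup>2) / (t - T)\<^sup>2))"

text \<open>The radial potential term is nonnegative since \<open>0 \<le> A\<close>, and the radial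
  kinetic energy is dropped. What remains is Hardy's inequality for the component orthogonal to the
  ray, whose constant is the source of the bound \<open>- 1/4\<close> on
  \<open>\<beta>\<close>.\<close>

lemma inverse_square_variation_nonneg:
  assumes ab: "a \<le> b" "T \<notin> {a..b}" and A: "0 \<le> A" "- 1/4 \<le> \<beta>"
    and d2: "inverse_square_variation U x \<theta> T A \<beta> a b" and h: "h \<in> W12_0 a b"
  shows "0 \<le> d2_action U x a b h"
proof -
  let ?h = "apply_bcontfun h" and ?e0 = "circle_point \<theta>" and ?e1 = "circle_point (\<theta> + pi/2)"
  obtain g where g: "has_L2_derivative a b ?h g"
    using h unfolding W12_0_def W12_def by blast
  have z: "?h a = 0" "?h b = 0" using h unfolding W12_0_def by auto
  have ne: "(t - T)\<^sup>2 \<noteq> 0" if "t \<in> {a..b}" for t using that ab(2) by auto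
  have 1: "(\<lambda>t. (?h t \<bullet> e)\<^sup>2 / (t - T)\<^sup>2) integrable_on {a..b}" for e
    using ne by (intro integrable_continuous_interval continuous_intros continuous_on_apply_bcontfun) auto
  have hardy: "integral {a..b} (\<lambda>t. (?h t \<bullet> ?e1)\<^sup>2 / (t - T)\<^sup>2) / 4 \<le> integral {a..b} (\<lambda>t. (g t \<bullet> ?e1)\<^sup>2)"
    using hardy_inequality[OF ab has_L2_derivative_inner[OF g]] z by simp
  also have "\<dots> \<le> integral {a..b} (\<lambda>t. (norm (g t))\<^sup>2)"
    by (rule integral_le[OF has_L2_derivative_inner(2)[OF g] has_L2_derivative_integrable(2)[OF g]])
      (simp add: circle_point_frame_norm[of _ \<theta>])
  finally have 2: "- integral {a..b} (\<lambda>t. (norm (g t))\<^sup>2) \<le> - integral {a..b} (\<lambda>t. (?h t \<bullet> ?e1)\<^sup>2 / (t - T)\<^sup>2) / 4"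
    by simp
  have "- integral {a..b} (\<lambda>t. (?h t \<bullet> ?e1)\<^sup>2 / (t - T)\<^sup>2) / 4
      = integral {a..b} (\<lambda>t. - 1/4 * ((?h t \<bullet> ?e1)\<^sup>2 / (t - T)\<^sup>2))"
    unfolding integral_mult_right by simp
  also have "\<dots> \<le> integral {a..b} (\<lambda>t. (A * (?h t \<bullet> ?e0)\<^sup>2 + \<beta> * (?h t \<bullet> ?e1)\<^sup>2) / (t - T)\<^sup>2)"
  proof (rule integral_le)
    show "(\<lambda>t. - 1/4 * ((?h t \<bullet> ?e1)\<^sup>2 / (t - T)\<^sup>2)) integrable_on {a..b}"
      by (intro integrable_on_mult_right 1)
    show "(\<lambda>t. (A * (?h t \<bullet> ?e0)\<^sup>2 + \<beta> * (?h t \<bullet> ?e1)\<^sup>2) / (t - T)\<^sup>2) integrable_on {a..b}"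
      using ne by (intro integrable_continuous_interval continuous_intros continuous_on_apply_bcontfun) auto
    fix t
    have "- 1/4 * (?h t \<bullet> ?e1)\<^sup>2 \<le> \<beta> * (?h t \<bullet> ?e1)\<^sup>2" using A(2) by (intro mult_right_mono) auto
    moreover have "0 \<le> A * (?h t \<bullet> ?e0)\<^sup>2" using A(1) by simp
    ultimately have "- 1/4 * (?h t \<bullet> ?e1)\<^sup>2 / (t - T)\<^sup>2 \<le> (A * (?h t \<bullet> ?e0)\<^sup>2 + \<beta> * (?h t \<bullet> ?e1)\<^sup>2) / (t - T)\<^sup>2"
      by (intro divide_right_mono) auto
    then show "- 1/4 * ((?h t \<bullet> ?e1)\<^sup>2 / (t - T)\<^sup>2) \<le> (A * (?h t \<bullet> ?e0)\<^sup>2 + \<beta> * (?h t \<bullet> ?e1)\<^sup>2) / (t - T)\<^sup>2"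
      by simp
  qed
  finally have 3: "- integral {a..b} (\<lambda>t. (?h t \<bullet> ?e1)\<^sup>2 / (t - T)\<^sup>2) / 4
      \<le> integral {a..b} (\<lambda>t. (A * (?h t \<bullet> ?e0)\<^sup>2 + \<beta> * (?h t \<bullet> ?e1)\<^sup>2) / (t - T)\<^sup>2)" .
  have "0 \<le> p + q" if "- p \<le> q" for p q :: real using that by linarith
  from this[OF order_trans[OF 2 3]] show ?thesis
    unfolding d2[unfolded inverse_square_variation_def, rule_format, OF g] .
qed

text \<open>A nonnegative form leaves the zero space as the only admissible subspace, and an
  independent subset of it is empty because it cannot contain \<open>0\<close>.\<close>

lemma morse_index_on_eq_0:
  assumes "\<And>h. h \<in> W12_0 a b \<Longrightarrow> 0 \<le> d2_action U x a b h"
  shows "morse_index_on U x a b = 0"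
proof -
  have "edim V \<le> 0" if V: "V \<subseteq> W12_0 a b" "\<forall>h\<in>V. h \<noteq> 0 \<longrightarrow> d2_action U x a b h < 0" for V
    unfolding edim_def
  proof (rule SUP_least)
    fix B assume B: "B \<in> {B. B \<subseteq> V \<and> finite B \<and> independent B}"
    have "V \<subseteq> {0}"
    proof
      fix h assume "h \<in> V"
      with V(1) have "0 \<le> d2_action U x a b h" by (intro assms) blast
      with V(2) \<open>h \<in> V\<close> show "h \<in> {0}" by (metis not_less singletonI)
    qed
    with B have "B \<subseteq> {0}" "0 \<notin> B" using dependent_zero by blast+
    then have "B = {}" by blast
    then show "enat (card B) \<le> 0" by (simp add: zero_enat_def)
  qed
  then have *: "edim V \<le> 0"
    if "V \<in> {V. subspace V \<and> V \<subseteq> W12_0 a b \<and> (\<forall>h\<in>V. h \<noteq> 0 \<longrightarrow> d2_action U x a b h < 0)}" for V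
    using that by simp
  have "morse_index_on U x a b \<le> 0"
    unfolding morse_index_on_def by (rule SUP_least) (rule *)
  then show ?thesis by simp
qed

section \<open>Negative directions with disjoint supports\<close>

lemma apply_bcontfun_sum_scaleR:
  "apply_bcontfun (\<Sum>k\<in>K. c k *\<^sub>R \<psi> k) t = (\<Sum>k\<in>K. c k *\<^sub>R apply_bcontfun (\<psi> k) t)"
  by (induct K rule: infinite_finite_induct)
    (auto simp: zero_bcontfun.rep_eq plus_bcontfun.rep_eq scaleR_bcontfun.rep_eq)

lemma power2_sum_disjoint:
  fixes f :: "'a \<Rightarrow> real"
  assumes "\<And>j k. j \<in> K \<Longrightarrow> k \<in> K \<Longrightarrow> j \<noteq> k \<Longrightarrow> f j * f k = 0" "finite K"
  shows "(\<Sum>k\<in>K. f k)\<^sup>2 = (\<Sum>k\<in>K. (f k)\<^sup>2)"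
proof -
  have "(\<Sum>k\<in>K. f k)\<^sup>2 = (\<Sum>j\<in>K. \<Sum>k\<in>K. f j * f k)"
    by (simp add: power2_eq_square sum_product)
  also have "\<dots> = (\<Sum>j\<in>K. \<Sum>k\<in>K. if k = j then f j * f j else 0)"
    using assms(1) by (intro sum.cong) auto
  also have "\<dots> = (\<Sum>j\<in>K. (f j)\<^sup>2)"
    using assms(2) by (simp add: power2_eq_square)
  finally show ?thesis .
qed

lemma has_L1_derivative_sum:
  assumes "\<And>k. k \<in> K \<Longrightarrow> has_L1_derivative a b (\<phi> k) (\<phi>' k)" "finite K"
  shows "has_L1_derivative a b (\<lambda>t. \<Sum>k\<in>K. c k * \<phi> k t) (\<lambda>t. \<Sum>k\<in>K. c k * \<phi>' k t)"
  unfolding has_L1_derivative_def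
proof (intro conjI ballI)
  show "(\<lambda>t. \<Sum>k\<in>K. c k * \<phi>' k t) absolutely_integrable_on {a..b}"
    using assms unfolding has_L1_derivative_def
    by (intro absolutely_integrable_sum set_integrable_mult_right) auto
  fix t assume t: "t \<in> {a..b}"
  have "((\<lambda>t. \<Sum>k\<in>K. c k * \<phi>' k t) has_integral (\<Sum>k\<in>K. c k * (\<phi> k t - \<phi> k a))) {a..t}"
    using has_L1_derivative_increment[OF assms(1), of _ a t] t
    by (intro has_integral_sum has_integral_mult_right assms(2)) auto
  then have "integral {a..t} (\<lambda>t. \<Sum>k\<in>K. c k * \<phi>' k t) = (\<Sum>k\<in>K. c k * (\<phi> k t - \<phi> k a))"
    by (rule integral_unique)
  then show "(\<Sum>k\<in>K. c k * \<phi> k t) = (\<Sum>k\<in>K. c k * \<phi> k a) + integral {a..t} (\<lambda>t. \<Sum>k\<in>K. c k * \<phi>' k t)"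
    by (simp add: right_diff_distrib sum_subtractf)
qed

lemma has_L2_derivative_scaleR:
  assumes "has_L1_derivative a b \<eta> g" "(\<lambda>t. (g t)\<^sup>2) absolutely_integrable_on {a..b}"
  shows "has_L2_derivative a b (\<lambda>t. \<eta> t *\<^sub>R e) (\<lambda>t. g t *\<^sub>R e)"
  unfolding has_L2_derivative_def
proof (intro conjI ballI)
  have g: "g absolutely_integrable_on {a..b}" using assms(1) unfolding has_L1_derivative_def by blast
  show "(\<lambda>t. g t *\<^sub>R e) absolutely_integrable_on {a..b}"
    using absolutely_integrable_linear[OF g bounded_linear_scaleR_left[of e]] by (simp add: o_def)
  have "(\<lambda>t. (norm e)\<^sup>2 * (g t)\<^sup>2) absolutely_integrable_on {a..b}"
    using assms(2) by (intro set_integrable_mult_right)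
  then show "(\<lambda>t. (norm (g t *\<^sub>R e))\<^sup>2) absolutely_integrable_on {a..b}"
    by (simp add: power_mult_distrib mult.commute)
  fix t assume t: "t \<in> {a..b}"
  then have "(g has_integral \<eta> t - \<eta> a) {a..t}"
    using has_L1_derivative_increment[OF assms(1), of a t] by simp
  from integral_unique[OF has_integral_scaleR_left[OF this, of e]]
  show "\<eta> t *\<^sub>R e = \<eta> a *\<^sub>R e + integral {a..t} (\<lambda>t. g t *\<^sub>R e)"
    by (simp add: scaleR_diff_left)
qed

text \<open>Bumps orthogonal to the ray with vanishing mutual products diagonalize the form: on a
  combination it is the sum of its values on the bumps, weighted by the squared coefficients. Hence
  their span is negative definite of dimension \<open>N\<close>. The products vanish at every point,
  for the bumps and for the chosen derivatives alike, so the squares split pointwise.\<close>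

lemma morse_index_on_ge:
  fixes \<phi> \<phi>' :: "nat \<Rightarrow> real \<Rightarrow> real"
  assumes ab: "a \<le> b" "T \<notin> {a..b}"
    and d2: "inverse_square_variation U x \<theta> T A \<beta> a b"
    and cont: "\<And>k. k < N \<Longrightarrow> continuous_on UNIV (\<phi> k)"
    and supp: "\<And>k t. k < N \<Longrightarrow> t \<notin> {a<..<b} \<Longrightarrow> \<phi> k t = 0"
    and nz: "\<And>k. k < N \<Longrightarrow> \<exists>t. \<phi> k t \<noteq> 0"
    and der: "\<And>k. k < N \<Longrightarrow> has_L1_derivative a b (\<phi> k) (\<phi>' k)"
    and sq: "\<And>k. k < N \<Longrightarrow> (\<lambda>t. (\<phi>' k t)\<^sup>2) absolutely_integrable_on {a..b}"
    and disj: "\<And>j k t. j < N \<Longrightarrow> k < N \<Longrightarrow> j \<noteq> k \<Longrightarrow> \<phi> j t * \<phi> k t = 0"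
    and disj': "\<And>j k t. j < N \<Longrightarrow> k < N \<Longrightarrow> j \<noteq> k \<Longrightarrow> \<phi>' j t * \<phi>' k t = 0"
    and neg: "\<And>k. k < N \<Longrightarrow> integral {a..b} (\<lambda>t. (\<phi>' k t)\<^sup>2 + \<beta> * (\<phi> k t)\<^sup>2 / (t - T)\<^sup>2) < 0"
  shows "enat N \<le> morse_index_on U x a b"
proof -
  let ?e0 = "circle_point \<theta>" and ?e1 = "circle_point (\<theta> + pi/2)"
  \<comment> \<open>\<open>Bcontfun\<close> is meaningful only for bounded continuous functions;
    boundedness comes from the support in a compact interval.\<close>
  define \<psi> where "\<psi> k = Bcontfun (\<lambda>t. \<phi> k t *\<^sub>R ?e1)" for k
  have \<psi>: "apply_bcontfun (\<psi> k) t = \<phi> k t *\<^sub>R ?e1" if k: "k < N" for k t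
  proof -
    have c: "continuous_on UNIV (\<lambda>t. \<phi> k t *\<^sub>R ?e1)" by (intro continuous_intros cont k)
    have "range (\<lambda>t. \<phi> k t *\<^sub>R ?e1) \<subseteq> insert 0 ((\<lambda>t. \<phi> k t *\<^sub>R ?e1) ` {a..b})"
      using supp[OF k] by (auto simp: image_iff) (metis atLeastAtMost_iff greaterThanLessThan_iff less_eq_real_def)
    moreover have "bounded (insert 0 ((\<lambda>t. \<phi> k t *\<^sub>R ?e1) ` {a..b}))"
      unfolding bounded_insert
      by (intro compact_imp_bounded compact_continuous_image compact_Icc continuous_on_subset[OF c]) simp
    ultimately have "bounded (range (\<lambda>t. \<phi> k t *\<^sub>R ?e1))" by (metis bounded_subset)
    with c have "(\<lambda>t. \<phi> k t *\<^sub>R ?e1) \<in> bcontfun" by (simp add: bcontfun_def)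
    then show ?thesis by (simp add: \<psi>_def Bcontfun_inverse)
  qed
  define comb where "comb c = (\<Sum>k<N. c k *\<^sub>R \<psi> k)" for c :: "nat \<Rightarrow> real"
  have comb: "apply_bcontfun (comb c) t = (\<Sum>k<N. c k * \<phi> k t) *\<^sub>R ?e1" for c t
    by (simp add: comb_def apply_bcontfun_sum_scaleR \<psi> scaleR_sum_left)
  have combD: "has_L2_derivative a b (apply_bcontfun (comb c)) (\<lambda>t. (\<Sum>k<N. c k * \<phi>' k t) *\<^sub>R ?e1)" for c
  proof -
    have "(\<lambda>t. (\<Sum>k<N. c k * \<phi>' k t)\<^sup>2) = (\<lambda>t. \<Sum>k<N. (c k)\<^sup>2 * (\<phi>' k t)\<^sup>2)"
      using disj' by (subst power2_sum_disjoint) (auto simp: power_mult_distrib)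
    moreover have "(\<lambda>t. \<Sum>k<N. (c k)\<^sup>2 * (\<phi>' k t)\<^sup>2) absolutely_integrable_on {a..b}"
      using sq by (intro absolutely_integrable_sum set_integrable_mult_right) auto
    ultimately have "has_L2_derivative a b (\<lambda>t. (\<Sum>k<N. c k * \<phi> k t) *\<^sub>R ?e1) (\<lambda>t. (\<Sum>k<N. c k * \<phi>' k t) *\<^sub>R ?e1)"
      using der by (intro has_L2_derivative_scaleR has_L1_derivative_sum) auto
    then show ?thesis by (simp add: comb[abs_def])
  qed
  have V0: "comb c \<in> W12_0 a b" for c
    using combD supp unfolding W12_0_def W12_def by (auto simp: comb)
  have Vneg: "d2_action U x a b (comb c) < 0" if "comb c \<noteq> 0" for c
  proof -
    let ?\<eta> = "\<lambda>t. \<Sum>k<N. c k * \<phi> k t" and ?g = "\<lambda>t. \<Sum>k<N. c k * \<phi>' k t"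
    let ?q = "\<lambda>k t. (\<phi>' k t)\<^sup>2 + \<beta> * (\<phi> k t)\<^sup>2 / (t - T)\<^sup>2"
    have ne: "(t - T)\<^sup>2 \<noteq> 0" if "t \<in> {a..b}" for t using that ab(2) by auto
    have cont': "continuous_on {a..b} (\<phi> k)" if "k < N" for k
      using cont[OF that] by (rule continuous_on_subset) simp
    have i1: "(\<lambda>t. (\<phi>' k t)\<^sup>2) integrable_on {a..b}" if "k < N" for k
      using sq[OF that] by (rule set_lebesgue_integral_eq_integral(1))
    have i2: "(\<lambda>t. \<beta> * (\<phi> k t)\<^sup>2 / (t - T)\<^sup>2) integrable_on {a..b}" if "k < N" for k
      using ne by (intro integrable_continuous_interval continuous_intros cont'[OF that]) auto
    have g2: "(?g t)\<^sup>2 = (\<Sum>k<N. (c k)\<^sup>2 * (\<phi>' k t)\<^sup>2)" for t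
      using disj' by (subst power2_sum_disjoint) (auto simp: power_mult_distrib)
    have \<eta>2: "(?\<eta> t)\<^sup>2 = (\<Sum>k<N. (c k)\<^sup>2 * (\<phi> k t)\<^sup>2)" for t
      using disj by (subst power2_sum_disjoint) (auto simp: power_mult_distrib)
    have "d2_action U x a b (comb c) = integral {a..b} (\<lambda>t. (?g t)\<^sup>2) + integral {a..b} (\<lambda>t. \<beta> * (?\<eta> t)\<^sup>2 / (t - T)\<^sup>2)"
      using d2 combD[of c] unfolding inverse_square_variation_def
      by (simp add: comb inner_circle_point)
    also have "integral {a..b} (\<lambda>t. (?g t)\<^sup>2) = (\<Sum>k<N. (c k)\<^sup>2 * integral {a..b} (\<lambda>t. (\<phi>' k t)\<^sup>2))"
      unfolding g2 using i1
      by (subst integral_sum) (auto intro: integrable_on_mult_right)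
    also have "integral {a..b} (\<lambda>t. \<beta> * (?\<eta> t)\<^sup>2 / (t - T)\<^sup>2)
        = (\<Sum>k<N. (c k)\<^sup>2 * integral {a..b} (\<lambda>t. \<beta> * (\<phi> k t)\<^sup>2 / (t - T)\<^sup>2))"
    proof -
      have e: "\<beta> * (?\<eta> t)\<^sup>2 / (t - T)\<^sup>2 = (\<Sum>k<N. (c k)\<^sup>2 * (\<beta> * (\<phi> k t)\<^sup>2 / (t - T)\<^sup>2))" for t
        unfolding \<eta>2 by (simp add: sum_distrib_left sum_divide_distrib mult_ac)
      have "((\<lambda>t. \<Sum>k<N. (c k)\<^sup>2 * (\<beta> * (\<phi> k t)\<^sup>2 / (t - T)\<^sup>2)) has_integral
          (\<Sum>k<N. (c k)\<^sup>2 * integral {a..b} (\<lambda>t. \<beta> * (\<phi> k t)\<^sup>2 / (t - T)\<^sup>2))) {a..b}"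
        using i2 by (intro has_integral_sum has_integral_mult_right integrable_integral) auto
      then show ?thesis unfolding e by (rule integral_unique)
    qed
    also have "(\<Sum>k<N. (c k)\<^sup>2 * integral {a..b} (\<lambda>t. (\<phi>' k t)\<^sup>2))
        + (\<Sum>k<N. (c k)\<^sup>2 * integral {a..b} (\<lambda>t. \<beta> * (\<phi> k t)\<^sup>2 / (t - T)\<^sup>2))
        = (\<Sum>k<N. (c k)\<^sup>2 * integral {a..b} (?q k))"
      unfolding sum.distrib[symmetric]
      by (rule sum.cong) (use i1 i2 in \<open>simp_all add: integral_add flip: distrib_left\<close>)
    finally have d: "d2_action U x a b (comb c) = (\<Sum>k<N. (c k)\<^sup>2 * integral {a..b} (?q k))" .
    have "\<exists>k<N. c k \<noteq> 0"
    proof (rule ccontr)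
      assume "\<not> ?thesis"
      then have "comb c = 0" by (simp add: comb_def)
      with that show False by simp
    qed
    then obtain k where k: "k < N" "c k \<noteq> 0" by blast
    have "(\<Sum>k<N. (c k)\<^sup>2 * integral {a..b} (?q k)) < (\<Sum>k<N. 0)"
    proof (rule sum_strict_mono_ex1)
      show "\<exists>k\<in>{..<N}. (c k)\<^sup>2 * integral {a..b} (?q k) < 0"
        using k neg[OF k(1)] by (intro bexI[of _ k]) (auto simp: mult_pos_neg)
      show "\<forall>k\<in>{..<N}. (c k)\<^sup>2 * integral {a..b} (?q k) \<le> 0"
        by (intro ballI mult_nonneg_nonpos zero_le_power2 less_imp_le neg) simp
    qed simp
    then show ?thesis unfolding d by simp
  qed
  define V where "V = range comb"
  have V: "subspace V"
    unfolding subspace_def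
  proof (intro conjI ballI allI)
    show "0 \<in> V" unfolding V_def by (rule range_eqI[of _ _ "\<lambda>_. 0"]) (simp add: comb_def)
    fix f assume "f \<in> V"
    then obtain c where c: "f = comb c" by (auto simp: V_def)
    show "s *\<^sub>R f \<in> V" for s
      unfolding V_def c by (rule range_eqI[of _ _ "\<lambda>k. s * c k"]) (simp add: comb_def scaleR_sum_right)
    fix g assume "g \<in> V"
    then obtain d where d: "g = comb d" by (auto simp: V_def)
    show "f + g \<in> V"
      unfolding V_def c d by (rule range_eqI[of _ _ "\<lambda>k. c k + d k"]) (simp add: comb_def scaleR_add_left sum.distrib)
  qed
  have "V \<in> {V. subspace V \<and> V \<subseteq> W12_0 a b \<and> (\<forall>h\<in>V. h \<noteq> 0 \<longrightarrow> d2_action U x a b h < 0)}"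
    using V V0 Vneg by (auto simp: V_def)
  then have 1: "edim V \<le> morse_index_on U x a b"
    unfolding morse_index_on_def by (rule SUP_upper)
  \<comment> \<open>At a point where \<open>\<phi> k\<close> is nonzero all the other bumps vanish,
    so evaluation there isolates the coefficient \<open>c k\<close>.\<close>
  have c0: "c k = 0" if "comb c = 0" "k < N" for c k
  proof -
    obtain t where t: "\<phi> k t \<noteq> 0" using nz[OF \<open>k < N\<close>] by blast
    have "\<phi> j t = 0" if "j < N" "j \<noteq> k" for j
      using disj[OF \<open>j < N\<close> \<open>k < N\<close> \<open>j \<noteq> k\<close>, of t] t by simp
    then have "(\<Sum>j<N. c j * \<phi> j t) = (\<Sum>j<N. if j = k then c k * \<phi> k t else 0)"
      by (intro sum.cong) auto
    also have "\<dots> = c k * \<phi> k t" using \<open>k < N\<close> by simp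
    finally have "(c k * \<phi> k t) *\<^sub>R ?e1 = 0"
      using comb[of c t] that(1) by (simp add: zero_bcontfun.rep_eq)
    then show ?thesis using t norm_circle_point[of "\<theta> + pi/2"]
      by (metis mult_eq_0_iff norm_zero scaleR_eq_0_iff zero_neq_one)
  qed
  have single: "comb (\<lambda>j. if j = k then 1 else 0) = \<psi> k" if "k < N" for k
    using that by (simp add: comb_def if_distrib[of "\<lambda>c. c *\<^sub>R _"] cong: if_cong)
  have inj: "inj_on \<psi> {..<N}"
  proof (rule inj_onI)
    fix j k assume jk: "j \<in> {..<N}" "k \<in> {..<N}" "\<psi> j = \<psi> k"
    \<comment> \<open>For distinct \<open>j\<close> and \<open>k\<close> the zero combination
      \<open>\<psi> j - \<psi> k\<close> would have coefficient \<open>1\<close> at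
      \<open>j\<close>.\<close>
    let ?c = "\<lambda>i. (if i = j then 1 else 0) - (if i = k then 1 else 0) :: real"
    have "comb ?c = comb (\<lambda>i. if i = j then 1 else 0) - comb (\<lambda>i. if i = k then 1 else 0)"
      by (simp only: comb_def scaleR_diff_left sum_subtractf)
    also have "\<dots> = 0" using jk by (simp add: single)
    finally have "?c j = 0" using c0 jk(1) by blast
    then show "j = k" by (simp split: if_splits)
  qed
  have "independent (\<psi> ` {..<N})"
  proof (rule independent_if_scalars_zero)
    fix u v assume u: "(\<Sum>v\<in>\<psi> ` {..<N}. u v *\<^sub>R v) = 0" and v: "v \<in> \<psi> ` {..<N}"
    have "comb (\<lambda>k. u (\<psi> k)) = 0"
      using u unfolding comb_def by (simp add: sum.reindex[OF inj])
    then show "u v = 0" using c0 v by blast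
  qed simp
  moreover have "\<psi> ` {..<N} \<subseteq> V" using single unfolding V_def by (metis image_subsetI lessThan_iff rangeI)
  ultimately have "enat (card (\<psi> ` {..<N})) \<le> edim V"
    unfolding edim_def by (intro SUP_upper) simp
  then have "enat N \<le> edim V" by (simp add: card_image[OF inj])
  with 1 show ?thesis by (rule order_trans[rotated])
qed

text \<open>The function \<open>sqrt \<bar>s\<bar> sin (\<omega> ln \<bar>s\<bar>)\<close> solves the Euler equation
  \<open>s\<^sup>2 \<phi>'' + (1/4 + \<omega>\<^sup>2) \<phi> = 0\<close>; a bump is its arc between two consecutive zeros.\<close>

lemma oscillating_bump:
  fixes T p q \<omega> \<beta> :: real
  assumes pq: "p < q" and sgn: "\<And>t. t \<in> {p..q} \<Longrightarrow> 0 < \<omega> * (t - T)"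
    and arc: "\<omega> * (ln ((q - T)\<^sup>2) / 2 - ln ((p - T)\<^sup>2) / 2) = pi"
    and neg: "1/4 + \<beta> + \<omega>\<^sup>2 < 0"
  obtains \<phi> \<phi>' :: "real \<Rightarrow> real" where
    "continuous_on UNIV \<phi>" "\<And>t. t \<notin> {p<..<q} \<Longrightarrow> \<phi> t = 0" "\<exists>t. \<phi> t \<noteq> 0"
    "\<And>t. t \<notin> {p..<q} \<Longrightarrow> \<phi>' t = 0"
    "\<And>a b. a \<le> p \<Longrightarrow> q \<le> b \<Longrightarrow> has_L1_derivative a b \<phi> \<phi>'"
    "\<And>a b. (\<lambda>t. (\<phi>' t)\<^sup>2) absolutely_integrable_on {a..b}"
    "\<And>a b. a \<le> p \<Longrightarrow> q \<le> b \<Longrightarrow> integral {a..b} (\<lambda>t. (\<phi>' t)\<^sup>2 + \<beta> * (\<phi> t)\<^sup>2 / (t - T)\<^sup>2) < 0"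
proof -
  \<comment> \<open>\<open>L t = ln \<bar>t - T\<bar>\<close>, squared so that differentiating needs no case distinction\<close>
  define L where "L t = ln ((t - T)\<^sup>2) / 2" for t
  \<comment> \<open>Subtracting \<open>L p\<close> shifts the phase so that it is \<open>0\<close>
    at \<open>p\<close>; by \<open>arc\<close> it then reaches \<open>pi\<close> at
    \<open>q\<close>.\<close>
  define u where "u t = \<omega> * (L t - L p)" for t
  define F where "F t = exp (L t / 2) * sin (u t)" for t
  define D where "D t = exp (L t / 2) * (sin (u t) / 2 + \<omega> * cos (u t)) / (t - T)" for t
  \<comment> \<open>\<open>F\<close> vanishes at \<open>p\<close> and \<open>q\<close>, so clamping
    the argument to \<open>{p..q}\<close> is extension by zero, and continuity is inherited by
    composition.\<close>
  define \<phi> where "\<phi> t = F (max p (min q t))" for t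
  \<comment> \<open>The half-open interval matters: consecutive arcs share an endpoint, and with
    this convention their derivatives are never both nonzero there.\<close>
  define \<phi>' where "\<phi>' t = (if t \<in> {p..<q} then D t else 0)" for t
  have ne: "t - T \<noteq> 0" "\<omega> \<noteq> 0" if "t \<in> {p..q}" for t using sgn[OF that] by auto
  have w0: "\<omega> \<noteq> 0" using ne(2)[of p] pq by simp
  have dL: "(L has_real_derivative 1 / (t - T)) (at t)" if "t \<in> {p..q}" for t
  proof -
    have pos: "0 < (t - T)\<^sup>2" using ne[OF that] by simp
    have "((\<lambda>t. (t - T)\<^sup>2) has_real_derivative 2 * (t - T)) (at t)"
      by (auto intro!: derivative_eq_intros)
    note DERIV_cdivide[OF DERIV_chain2[OF DERIV_ln[OF pos] this], of 2]
    moreover have "inverse (d\<^sup>2) * (2 * d) / 2 = 1 / d" if "d \<noteq> 0" for d :: real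
      using that by (simp add: power2_eq_square inverse_eq_divide)
    from this[OF ne(1)[OF that]]
    have "inverse ((t - T)\<^sup>2) * (2 * (t - T)) / 2 = 1 / (t - T)" .
    ultimately show ?thesis unfolding L_def[abs_def] by (simp only:)
  qed
  have du: "(u has_real_derivative \<omega> / (t - T)) (at t)" if "t \<in> {p..q}" for t
    unfolding u_def[abs_def] by (auto intro!: derivative_eq_intros dL[OF that])
  have dF: "(F has_real_derivative D t) (at t)" if "t \<in> {p..q}" for t
  proof -
    have "(F has_real_derivative exp (L t / 2) * (1 / (t - T) / 2) * sin (u t)
        + cos (u t) * (\<omega> / (t - T)) * exp (L t / 2)) (at t)"
      unfolding F_def[abs_def]
      by (intro DERIV_mult DERIV_chain2[OF DERIV_exp] DERIV_chain2[OF DERIV_sin] DERIV_cdivide dL du that)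
    moreover have "exp (L t / 2) * (1 / (t - T) / 2) * sin (u t) + cos (u t) * (\<omega> / (t - T)) * exp (L t / 2) = D t"
      by (simp add: D_def add_divide_distrib distrib_left mult_ac)
    ultimately show ?thesis by simp
  qed
  have cu: "continuous_on {p..q} u" using du DERIV_isCont by (blast intro: continuous_at_imp_continuous_on)
  have cL: "continuous_on {p..q} L" using dL DERIV_isCont by (blast intro: continuous_at_imp_continuous_on)
  have cF: "continuous_on {p..q} F" using dF DERIV_isCont by (blast intro: continuous_at_imp_continuous_on)
  have cD: "continuous_on {p..q} D"
    unfolding D_def using ne by (intro continuous_intros cu cL) auto
  have up: "u p = 0" "u q = pi" using arc by (simp_all add: u_def L_def)
  then have Fp: "F p = 0" "F q = 0" by (simp_all add: F_def)
  have \<phi>in: "\<phi> t = F t" if "t \<in> {p..q}" for t using that by (simp add: \<phi>_def)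
  have \<phi>out: "\<phi> t = 0" if "t \<notin> {p<..<q}" for t
  proof -
    have "max p (min q t) = p \<or> max p (min q t) = q" using that pq by auto
    then show ?thesis using Fp by (auto simp: \<phi>_def)
  qed
  have c\<phi>: "continuous_on UNIV \<phi>"
    unfolding \<phi>_def[abs_def]
    by (rule continuous_on_compose2[OF cF]) (use pq in \<open>auto intro!: continuous_intros\<close>)
  have ai: "(\<lambda>t. if t \<in> {p..<q} then G t else 0) absolutely_integrable_on {a..b}"
    if "continuous_on {p..q} G" for a b and G :: "real \<Rightarrow> real"
  proof -
    have "G absolutely_integrable_on {p..q}" using that by (rule absolutely_integrable_continuous_real)
    then have "G absolutely_integrable_on {p..<q}" by (rule set_integrable_subset) auto
    then have "(\<lambda>t. if t \<in> {p..<q} then G t else 0) absolutely_integrable_on UNIV"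
      by (simp only: absolutely_integrable_restrict_UNIV)
    then show ?thesis by (rule set_integrable_subset) auto
  qed
  have sq: "(\<phi>' t)\<^sup>2 = (if t \<in> {p..<q} then (D t)\<^sup>2 else 0)" for t by (simp add: \<phi>'_def)
  have d\<phi>: "has_L1_derivative a b \<phi> \<phi>'" if "a \<le> p" "q \<le> b" for a b
    unfolding has_L1_derivative_def
  proof (intro conjI ballI)
    show "\<phi>' absolutely_integrable_on {a..b}"
      unfolding \<phi>'_def[abs_def] by (rule ai[OF cD])
    fix t assume t: "t \<in> {a..b}"
    have "(\<phi>' has_integral \<phi> t - \<phi> a) {a..t}"
    proof (rule fundamental_theorem_of_calculus_interior_strong[of "{p, q}"])
      fix s assume s: "s \<in> {a<..<t} - {p, q}"
      consider "s < p" | "q < s" | "p < s" "s < q" using s by fastforce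
      then have "(\<phi> has_real_derivative \<phi>' s) (at s)"
      proof cases
        case 1
        have "((\<lambda>_. 0) has_real_derivative 0) (at s)" by simp
        then have "(\<phi> has_real_derivative 0) (at s)"
          by (rule has_field_derivative_transform_within_open[of _ _ _ "{..<p}"]) (use 1 \<phi>out in auto)
        then show ?thesis using 1 by (simp add: \<phi>'_def)
      next
        case 2
        have "((\<lambda>_. 0) has_real_derivative 0) (at s)" by simp
        then have "(\<phi> has_real_derivative 0) (at s)"
          by (rule has_field_derivative_transform_within_open[of _ _ _ "{q<..}"]) (use 2 \<phi>out in auto)
        then show ?thesis using 2 by (simp add: \<phi>'_def)
      next
        case 3
        have "(F has_real_derivative D s) (at s)" using 3 by (intro dF) simp
        then have "(\<phi> has_real_derivative D s) (at s)"
          by (rule has_field_derivative_transform_within_open[of _ _ _ "{p<..<q}"]) (use 3 \<phi>in in auto)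
        then show ?thesis using 3 by (simp add: \<phi>'_def)
      qed
      then show "(\<phi> has_vector_derivative \<phi>' s) (at s)"
        by (simp add: has_real_derivative_iff_has_vector_derivative)
    qed (use t in \<open>auto intro: continuous_on_subset[OF c\<phi>]\<close>)
    from integral_unique[OF this] show "\<phi> t = \<phi> a + integral {a..t} \<phi>'" by linarith
  qed
  have nz: "\<exists>t. \<phi> t \<noteq> 0"
  proof -
    obtain t where t: "t \<in> {p..q}" "u t = pi / 2"
      using IVT'[of u p "pi/2" q] up pq cu by (auto simp: field_simps)
    then have "\<phi> t = exp (L t / 2)" by (simp only: \<phi>in F_def t(2) sin_pi_half mult_1_right)
    then have "\<phi> t \<noteq> 0" by simp
    then show ?thesis by blast
  qed
  \<comment> \<open>An antiderivative of the integrand of the form, written in the phase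
    \<open>x = u t\<close>; the three summands integrate the \<open>sin^2\<close>, the mixed and the
    \<open>cos^2\<close> term.\<close>
  define B where "B x = (1/4 + \<beta>) * (x - sin x * cos x) / 2 + \<omega> * (sin x)\<^sup>2 / 2 + \<omega>\<^sup>2 * (x + sin x * cos x) / 2" for x :: real
  have dB: "(B has_real_derivative (sin x / 2 + \<omega> * cos x)\<^sup>2 + \<beta> * (sin x)\<^sup>2) (at x)" for x
  proof -
    have c: "cos x * cos x = 1 - sin x * sin x"
      using sin_cos_squared_add[of x] by (simp add: power2_eq_square)
    have sc: "((\<lambda>x. sin x * cos x) has_real_derivative cos x * cos x - sin x * sin x) (at x)"
      and ss: "((\<lambda>x. (sin x)\<^sup>2) has_real_derivative 2 * sin x * cos x) (at x)"
      by (auto intro!: derivative_eq_intros)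
    have "(B has_real_derivative (1/4 + \<beta>) * (1 - (cos x * cos x - sin x * sin x)) / 2
        + \<omega> * (2 * sin x * cos x) / 2 + \<omega>\<^sup>2 * (1 + (cos x * cos x - sin x * sin x)) / 2) (at x)"
      unfolding B_def[abs_def]
      by (intro DERIV_add DERIV_diff DERIV_cdivide DERIV_cmult DERIV_ident sc ss)
    moreover have "(1/4 + \<beta>) * (1 - (cos x * cos x - sin x * sin x)) / 2
        + \<omega> * (2 * sin x * cos x) / 2 + \<omega>\<^sup>2 * (1 + (cos x * cos x - sin x * sin x)) / 2
        = (sin x / 2 + \<omega> * cos x)\<^sup>2 + \<beta> * (sin x)\<^sup>2"
      unfolding power2_sum power_mult_distrib power2_eq_square[of "cos x"] c
      by (simp add: power2_eq_square field_simps)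
    ultimately show ?thesis by simp
  qed
  \<comment> \<open>Because \<open>exp (L t / 2)^2 = \<bar>t - T\<bar>\<close>, both terms of the
    integrand are the phase integrand divided by \<open>\<bar>t - T\<bar>\<close>. The phase
    increases at rate \<open>\<bar>\<omega>\<bar> / \<bar>t - T\<bar>\<close>, so changing variables
    to it leaves just the factor \<open>1 / \<bar>\<omega>\<bar>\<close>.\<close>
  have int: "((\<lambda>t. (D t)\<^sup>2 + \<beta> * (F t)\<^sup>2 / (t - T)\<^sup>2) has_integral
      B (u q) / \<bar>\<omega>\<bar> - B (u p) / \<bar>\<omega>\<bar>) {p..q}"
  proof (rule fundamental_theorem_of_calculus)
    fix t assume t: "t \<in> {p..q}"
    have "((\<lambda>t. B (u t) / \<bar>\<omega>\<bar>) has_real_derivative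
        ((sin (u t) / 2 + \<omega> * cos (u t))\<^sup>2 + \<beta> * (sin (u t))\<^sup>2) * (\<omega> / (t - T)) / \<bar>\<omega>\<bar>) (at t)"
      by (intro DERIV_cdivide DERIV_chain2[OF dB] du t)
    moreover have "((sin (u t) / 2 + \<omega> * cos (u t))\<^sup>2 + \<beta> * (sin (u t))\<^sup>2) * (\<omega> / (t - T)) / \<bar>\<omega>\<bar>
        = (D t)\<^sup>2 + \<beta> * (F t)\<^sup>2 / (t - T)\<^sup>2"
    proof -
      have "exp (L t / 2) * exp (L t / 2) = exp (L t)" by (simp flip: exp_add)
      moreover have "exp (L t) * exp (L t) = (t - T)\<^sup>2"
        using ne[OF t] by (simp add: L_def flip: exp_add)
      then have "exp (L t) = \<bar>t - T\<bar>"
        by (metis abs_exp_cancel abs_mult_self_eq power2_eq_square power2_eq_iff_nonneg abs_ge_zero power2_abs)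
      ultimately have e: "(exp (L t / 2))\<^sup>2 = \<bar>t - T\<bar>" by (simp add: power2_eq_square)
      have "\<omega> / (t - T) / \<bar>\<omega>\<bar> = \<bar>t - T\<bar> / (t - T)\<^sup>2"
      proof -
        have "\<bar>\<omega>\<bar> * \<bar>t - T\<bar> = \<omega> * (t - T)" using sgn[OF t] by (simp flip: abs_mult)
        then show ?thesis using ne[OF t] by (simp add: power2_eq_square divide_simps mult.commute)
      qed
      then have "X * (\<omega> / (t - T)) / \<bar>\<omega>\<bar> = X * (\<bar>t - T\<bar> / (t - T)\<^sup>2)" for X
        by (metis times_divide_eq_right)
      moreover have "(D t)\<^sup>2 + \<beta> * (F t)\<^sup>2 / (t - T)\<^sup>2 =
          ((sin (u t) / 2 + \<omega> * cos (u t))\<^sup>2 + \<beta> * (sin (u t))\<^sup>2) * ((exp (L t / 2))\<^sup>2 / (t - T)\<^sup>2)"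
        unfolding D_def F_def power_divide power_mult_distrib
        by (simp add: distrib_right distrib_left add_divide_distrib mult_ac)
      ultimately show ?thesis by (simp only: e)
    qed
    ultimately show "((\<lambda>t. B (u t) / \<bar>\<omega>\<bar>) has_vector_derivative (D t)\<^sup>2 + \<beta> * (F t)\<^sup>2 / (t - T)\<^sup>2) (at t within {p..q})"
      by (metis has_field_derivative_at_within has_real_derivative_iff_has_vector_derivative)
  qed (use pq in simp)
  \<comment> \<open>Over a half period \<open>sin^2\<close> and \<open>cos^2\<close> both integrate
    to \<open>pi / 2\<close> and the mixed term cancels, which explains the combination in
    \<open>neg\<close>.\<close>
  have "B pi - B 0 = (1/4 + \<beta> + \<omega>\<^sup>2) * (pi / 2)"
    by (simp add: B_def algebra_simps)
  also have "\<dots> < 0" using neg by (intro mult_neg_pos) auto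
  finally have Bneg: "B (u q) / \<bar>\<omega>\<bar> - B (u p) / \<bar>\<omega>\<bar> < 0"
    unfolding up using w0 by (simp add: divide_strict_right_mono)
  have "integral {a..b} (\<lambda>t. (\<phi>' t)\<^sup>2 + \<beta> * (\<phi> t)\<^sup>2 / (t - T)\<^sup>2) < 0" if ab: "a \<le> p" "q \<le> b" for a b
  proof -
    let ?G = "\<lambda>t. (D t)\<^sup>2 + \<beta> * (F t)\<^sup>2 / (t - T)\<^sup>2"
    have sub: "{p..q} \<inter> {a..b} = {p..q}" using ab by auto
    have "((\<lambda>t. if t \<in> {p..q} then ?G t else 0) has_integral B (u q) / \<bar>\<omega>\<bar> - B (u p) / \<bar>\<omega>\<bar>) {a..b}"
      using int unfolding has_integral_restrict_Int sub .
    then have "((\<lambda>t. (\<phi>' t)\<^sup>2 + \<beta> * (\<phi> t)\<^sup>2 / (t - T)\<^sup>2) has_integral B (u q) / \<bar>\<omega>\<bar> - B (u p) / \<bar>\<omega>\<bar>) {a..b}"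
    \<comment> \<open>The integrands disagree at \<open>q\<close>, where \<open>\<phi>'\<close> is
      \<open>0\<close> by convention and \<open>D\<close> is not.\<close>
    proof (rule has_integral_spike[of "{q}", rotated 2])
      fix t assume "t \<in> {a..b} - {q}"
      then consider "t \<in> {p..<q}" | "t \<notin> {p..q}" by fastforce
      then show "(\<phi>' t)\<^sup>2 + \<beta> * (\<phi> t)\<^sup>2 / (t - T)\<^sup>2 = (if t \<in> {p..q} then ?G t else 0)"
      proof cases
        case 1 then show ?thesis by (simp add: \<phi>'_def \<phi>in)
      next
        case 2
        then have "\<phi> t = 0" "\<phi>' t = 0" using \<phi>out[of t] by (auto simp: \<phi>'_def)
        then show ?thesis using 2 by (simp del: atLeastAtMost_iff)
      qed
    qed simp
    then show ?thesis using Bneg by (simp add: integral_unique)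
  qed
  moreover have "(\<lambda>t. (\<phi>' t)\<^sup>2) absolutely_integrable_on {a..b}" for a b
    unfolding sq by (rule ai) (intro continuous_intros cD)
  moreover have "\<phi>' t = 0" if "t \<notin> {p..<q}" for t using that by (auto simp: \<phi>'_def)
  ultimately show ?thesis using that[of \<phi> \<phi>'] c\<phi> \<phi>out nz d\<phi> by blast
qed

text \<open>Equal steps in \<open>ln \<bar>t - T\<bar>\<close> make \<open>t - T\<close> a geometric
  progression. Since \<open>\<omega>\<close> carries the sign of \<open>a - T\<close>, the times
  increase in both cases: away from the collision after it, towards it before it.\<close>

lemma geometric_times:
  fixes T a \<omega> :: real
  assumes a: "0 < \<omega> * (a - T)"
  defines "\<tau> \<equiv> \<lambda>k::nat. T + (a - T) * exp (real k * pi / \<omega>)"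
  shows "strict_mono \<tau>" "\<tau> 0 = a"
    and "\<omega> * (ln ((\<tau> (Suc k) - T)\<^sup>2) / 2 - ln ((\<tau> k - T)\<^sup>2) / 2) = pi"
proof -
  have w: "\<omega> \<noteq> 0" "a - T \<noteq> 0" using a by auto
  show "\<tau> 0 = a" by (simp add: \<tau>_def)
  show "strict_mono \<tau>"
  proof (rule strict_monoI_Suc)
    fix k
    have "0 < (a - T) * (exp (pi / \<omega>) - 1)"
    proof (cases "\<omega> > 0")
      case True
      then have "0 < a - T" "1 < exp (pi / \<omega>)" using a by (simp_all add: zero_less_mult_iff)
      then show ?thesis by simp
    next
      case False
      then have "\<omega> < 0" using w by simp
      moreover from this have "a - T < 0" using a by (simp add: zero_less_mult_iff)
      moreover have "exp (pi / \<omega>) < 1" using \<open>\<omega> < 0\<close> by (simp add: divide_pos_neg)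
      ultimately show ?thesis by (intro mult_neg_neg) auto
    qed
    then have "0 < exp (real k * pi / \<omega>) * ((a - T) * (exp (pi / \<omega>) - 1))" by simp
    also have "\<dots> = \<tau> (Suc k) - \<tau> k"
      by (simp add: \<tau>_def add_divide_distrib distrib_right exp_add algebra_simps)
    finally show "\<tau> k < \<tau> (Suc k)" by simp
  qed
  have "ln ((\<tau> k - T)\<^sup>2) = ln ((a - T)\<^sup>2) + 2 * (real k * pi / \<omega>)" for k
    using w by (simp add: \<tau>_def power_mult_distrib ln_mult ln_realpow flip: exp_double)
  then show "\<omega> * (ln ((\<tau> (Suc k) - T)\<^sup>2) / 2 - ln ((\<tau> k - T)\<^sup>2) / 2) = pi"
    using w by (simp add: field_simps)
qed

text \<open>The assumption \<open>long\<close> says that the geometric time with index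
  \<open>N\<close> is not beyond \<open>b\<close>, so \<open>N\<close> consecutive arcs starting at
  \<open>a\<close> fit into the interval, and each of them supplies a bump.\<close>

lemma morse_index_on_ge_oscillations:
  assumes ab: "a \<le> b" and sgn: "\<And>t. t \<in> {a..b} \<Longrightarrow> 0 < \<omega> * (t - T)"
    and neg: "1/4 + \<beta> + \<omega>\<^sup>2 < 0"
    and long: "T + (a - T) * exp (real N * pi / \<omega>) \<le> b"
    and d2: "inverse_square_variation U x \<theta> T A \<beta> a b"
  shows "enat N \<le> morse_index_on U x a b"
proof -
  define \<tau> where "\<tau> k = T + (a - T) * exp (real k * pi / \<omega>)" for k :: nat
  have "0 < \<omega> * (a - T)" using sgn ab by simp
  then have geo: "strict_mono \<tau>" "\<tau> 0 = a"
    "\<omega> * (ln ((\<tau> (Suc k) - T)\<^sup>2) / 2 - ln ((\<tau> k - T)\<^sup>2) / 2) = pi" for k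
    unfolding \<tau>_def[abs_def] by (rule geometric_times)+
  have mono: "\<tau> j \<le> \<tau> k" if "j \<le> k" for j k
    using geo(1) that by (simp add: strict_mono_less_eq)
  have in_ab: "a \<le> \<tau> k" "\<tau> (Suc k) \<le> b" "\<tau> k < \<tau> (Suc k)" if "k < N" for k
    using mono[of 0 k] mono[of "Suc k" N] that geo(1,2) long by (auto simp: \<tau>_def strict_mono_Suc_iff)
  have sgn': "0 < \<omega> * (t - T)" if "k < N" "t \<in> {\<tau> k..\<tau> (Suc k)}" for k t
    using in_ab[OF that(1)] that(2) by (intro sgn) auto
  \<comment> \<open>All properties of one bump in a single predicate, so that the families
    \<open>\<phi>\<close> and \<open>\<phi>'\<close> can be chosen together.\<close>
  define P where "P k \<phi> \<phi>' \<longleftrightarrow> continuous_on UNIV \<phi> \<and>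
    (\<forall>t. t \<notin> {\<tau> k<..<\<tau> (Suc k)} \<longrightarrow> \<phi> t = 0) \<and> (\<exists>t. \<phi> t \<noteq> 0) \<and>
    (\<forall>t. t \<notin> {\<tau> k..<\<tau> (Suc k)} \<longrightarrow> \<phi>' t = 0) \<and> has_L1_derivative a b \<phi> \<phi>' \<and>
    (\<lambda>t. (\<phi>' t)\<^sup>2) absolutely_integrable_on {a..b} \<and>
    integral {a..b} (\<lambda>t. (\<phi>' t)\<^sup>2 + \<beta> * (\<phi> t)\<^sup>2 / (t - T)\<^sup>2) < 0" for k and \<phi> \<phi>' :: "real \<Rightarrow> real"
  have "\<exists>\<phi> \<phi>'. P k \<phi> \<phi>'" if k: "k < N" for k
  proof (rule oscillating_bump[OF in_ab(3)[OF k] sgn'[OF k] geo(3) neg])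
    fix \<phi> \<phi>' :: "real \<Rightarrow> real"
    assume *: "continuous_on UNIV \<phi>" "\<And>t. t \<notin> {\<tau> k<..<\<tau> (Suc k)} \<Longrightarrow> \<phi> t = 0" "\<exists>t. \<phi> t \<noteq> 0"
      "\<And>t. t \<notin> {\<tau> k..<\<tau> (Suc k)} \<Longrightarrow> \<phi>' t = 0"
      "\<And>a b. a \<le> \<tau> k \<Longrightarrow> \<tau> (Suc k) \<le> b \<Longrightarrow> has_L1_derivative a b \<phi> \<phi>'"
      "\<And>a b. (\<lambda>t. (\<phi>' t)\<^sup>2) absolutely_integrable_on {a..b}"
      "\<And>a b. a \<le> \<tau> k \<Longrightarrow> \<tau> (Suc k) \<le> b \<Longrightarrow>
        integral {a..b} (\<lambda>t. (\<phi>' t)\<^sup>2 + \<beta> * (\<phi> t)\<^sup>2 / (t - T)\<^sup>2) < 0"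
    show ?thesis
      unfolding P_def
      by (intro exI[of _ \<phi>] exI[of _ \<phi>'] conjI allI impI)
        (rule *(1), erule *(2), rule *(3), erule *(4), rule *(5)[OF in_ab(1,2)[OF k]], rule *(6),
          rule *(7)[OF in_ab(1,2)[OF k]])
  qed
  then obtain \<phi> \<phi>' where "\<And>k. k < N \<Longrightarrow> P k (\<phi> k) (\<phi>' k)" by metis
  note \<phi> = this[unfolded P_def]
  \<comment> \<open>Half-open arcs are disjoint even when consecutive; for the bumps, which are
    supported in the open arcs, this is more than enough.\<close>
  have disj: "t \<notin> {\<tau> j..<\<tau> (Suc j)} \<or> t \<notin> {\<tau> k..<\<tau> (Suc k)}" if "j \<noteq> k" for j k t
  proof (cases "j < k")
    case True
    then show ?thesis using mono[of "Suc j" k] by auto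
  next
    case False
    then show ?thesis using that mono[of "Suc k" j] by auto
  qed
  show ?thesis
  proof (rule morse_index_on_ge[OF ab _ d2, of N \<phi> \<phi>'])
    show "T \<notin> {a..b}" using sgn by force
    show "\<phi> k t = 0" if "k < N" "t \<notin> {a<..<b}" for k t
    proof -
      have "t \<notin> {\<tau> k<..<\<tau> (Suc k)}" using in_ab[OF \<open>k < N\<close>] that(2) by auto
      then show ?thesis using \<phi>[OF \<open>k < N\<close>] by blast
    qed
    show "\<phi> j t * \<phi> k t = 0" if "j < N" "k < N" "j \<noteq> k" for j k t
    proof -
      have "t \<notin> {\<tau> j<..<\<tau> (Suc j)} \<or> t \<notin> {\<tau> k<..<\<tau> (Suc k)}" using disj[OF \<open>j \<noteq> k\<close>, of t] by auto
      then show ?thesis using \<phi>[OF \<open>j < N\<close>] \<phi>[OF \<open>k < N\<close>] by auto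
    qed
    show "\<phi>' j t * \<phi>' k t = 0" if "j < N" "k < N" "j \<noteq> k" for j k t
      using disj[OF \<open>j \<noteq> k\<close>, of t] \<phi>[OF \<open>j < N\<close>] \<phi>[OF \<open>k < N\<close>] by auto
  qed (use \<phi> in blast)+
qed

section \<open>From the motion to its Morse index\<close>

lemma has_L2_derivative_C1:
  assumes "\<And>t. t \<in> {a..b} \<Longrightarrow> (y has_vector_derivative v t) (at t)" and v: "continuous_on {a..b} v"
  shows "has_L2_derivative a b y v"
  unfolding has_L2_derivative_def
proof (intro conjI ballI)
  show "v absolutely_integrable_on {a..b}" "(\<lambda>t. (norm (v t))\<^sup>2) absolutely_integrable_on {a..b}"
    by (intro absolutely_integrable_continuous_real continuous_intros v)+
  fix t assume t: "t \<in> {a..b}"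
  have "(v has_integral y t - y a) {a..t}"
    by (rule fundamental_theorem_of_calculus)
      (use t assms(1) in \<open>auto intro: has_vector_derivative_at_within\<close>)
  from integral_unique[OF this] show "y t = y a + integral {a..t} v" by simp
qed

text \<open>Inserting the inverse square law for \<open>r powr (- \<alpha> - 2)\<close> divides the
  Hessian by \<open>angular \<UU> \<theta>\<close>. The value cancels in the radial coefficient,
  which depends on \<open>\<alpha>\<close> alone, and survives in the angular one only through the
  ratio with the second derivative.\<close>

lemma homothetic_inverse_square_variation:
  assumes \<alpha>: "0 < \<alpha>" and \<UU>: "C2_circle \<UU>" "deriv (angular \<UU>) \<theta> = 0" and u: "0 < angular \<UU> \<theta>"
    and x: "\<And>t. t \<in> {a..b} \<Longrightarrow> (x has_vector_derivative v t) (at t)"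
    and v: "continuous_on {a..b} v" and r: "continuous_on {a..b} r"
    and xr: "\<And>t. t \<in> {a..b} \<Longrightarrow> 0 < r t \<and> x t = r t *\<^sub>R circle_point \<theta>"
    and kepler: "\<And>t. t \<in> {a..b} \<Longrightarrow> r t powr (- \<alpha> - 2) = 2 / ((\<alpha> + 2)\<^sup>2 * angular \<UU> \<theta> * (t - T)\<^sup>2)"
  shows "inverse_square_variation (potential \<alpha> \<UU>) x \<theta> T (2 * \<alpha> * (\<alpha> + 1) / (\<alpha> + 2)\<^sup>2)
    (2 * (deriv (deriv (angular \<UU>)) \<theta> - \<alpha> * angular \<UU> \<theta>) / ((\<alpha> + 2)\<^sup>2 * angular \<UU> \<theta>)) a b"
    (is "inverse_square_variation _ _ _ _ ?A ?\<beta> _ _")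
  unfolding inverse_square_variation_def
proof (intro allI impI)
  fix h g assume g: "has_L2_derivative a b (apply_bcontfun h) g"
  let ?u = "angular \<UU> \<theta>" and ?u2 = "deriv (deriv (angular \<UU>)) \<theta>"
  have "has_L2_derivative a b x v" using x v by (rule has_L2_derivative_C1)
  then have x': "has_L2_derivative a b (\<lambda>t. r t *\<^sub>R circle_point \<theta>) v"
  proof (cases "a \<le> b")
    case True
    then have "a \<in> {a..b}" by simp
    with \<open>has_L2_derivative a b x v\<close> show ?thesis
      unfolding has_L2_derivative_def using xr by metis
  qed (simp add: has_L2_derivative_def)
  have "integral {a..b} (\<lambda>t. r t powr (- \<alpha> - 2) *
      (\<alpha> * (\<alpha> + 1) * ?u * (apply_bcontfun h t \<bullet> circle_point \<theta>)\<^sup>2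
        + (?u2 - \<alpha> * ?u) * (apply_bcontfun h t \<bullet> circle_point (\<theta> + pi/2))\<^sup>2))
    = integral {a..b} (\<lambda>t. (?A * (apply_bcontfun h t \<bullet> circle_point \<theta>)\<^sup>2
        + ?\<beta> * (apply_bcontfun h t \<bullet> circle_point (\<theta> + pi/2))\<^sup>2) / (t - T)\<^sup>2)"
  proof (rule integral_cong)
    fix t assume t: "t \<in> {a..b}"
    have "2 / (k * w * s) * (\<alpha> * (\<alpha> + 1) * w * X + Z * Y) = (2 * \<alpha> * (\<alpha> + 1) / k * X + 2 * Z / (k * w) * Y) / s"
      if "w \<noteq> 0" for k w s X Y Z :: real
      using that by (simp add: add_divide_distrib distrib_left mult_ac)
    then show "r t powr (- \<alpha> - 2) *
      (\<alpha> * (\<alpha> + 1) * ?u * (apply_bcontfun h t \<bullet> circle_point \<theta>)\<^sup>2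
        + (?u2 - \<alpha> * ?u) * (apply_bcontfun h t \<bullet> circle_point (\<theta> + pi/2))\<^sup>2)
      = (?A * (apply_bcontfun h t \<bullet> circle_point \<theta>)\<^sup>2
        + ?\<beta> * (apply_bcontfun h t \<bullet> circle_point (\<theta> + pi/2))\<^sup>2) / (t - T)\<^sup>2"
      unfolding kepler[OF t] using u by simp
  qed
  moreover have "d2_action (potential \<alpha> \<UU>) x a b h = integral {a..b} (\<lambda>t. (norm (g t))\<^sup>2)
    + integral {a..b} (\<lambda>t. r t powr (- \<alpha> - 2) *
      (\<alpha> * (\<alpha> + 1) * ?u * (apply_bcontfun h t \<bullet> circle_point \<theta>)\<^sup>2
        + (?u2 - \<alpha> * ?u) * (apply_bcontfun h t \<bullet> circle_point (\<theta> + pi/2))\<^sup>2))"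
    using xr by (intro d2_action_eq[OF \<UU> x' v r _ g]) blast+
  ultimately show "d2_action (potential \<alpha> \<UU>) x a b h = integral {a..b} (\<lambda>t. (norm (g t))\<^sup>2)
    + integral {a..b} (\<lambda>t. (?A * (apply_bcontfun h t \<bullet> circle_point \<theta>)\<^sup>2
        + ?\<beta> * (apply_bcontfun h t \<bullet> circle_point (\<theta> + pi/2))\<^sup>2) / (t - T)\<^sup>2)"
    by (simp only:)
qed

text \<open>The identity \<open>(\<alpha> + 2)^2 - 8 * \<alpha> = (2 - \<alpha>)^2\<close> is behind
  this, and behind the shape of \<open>\<Delta>\<close>: up to a positive factor,
  \<open>\<Delta>\<close> is the signed distance of the angular coefficient from the Hardy threshold
  \<open>- 1/4\<close>.\<close>

lemma \<Delta>_hardy_constant: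
  assumes "0 < \<alpha>" "0 < angular \<UU> \<theta>"
  shows "1/4 + 2 * (deriv (deriv (angular \<UU>)) \<theta> - \<alpha> * angular \<UU> \<theta>) / ((\<alpha> + 2)\<^sup>2 * angular \<UU> \<theta>)
    = \<Delta> \<alpha> \<UU> \<theta> / (2 * (\<alpha> + 2)\<^sup>2 * angular \<UU> \<theta>)"
proof -
  have "1/4 + 2 * (y - \<alpha> * w) / (k * w) = (k * w + 8 * (y - \<alpha> * w)) / (4 * k * w)"
    if "k \<noteq> 0" "w \<noteq> 0" for k w y :: real
    using that by (simp add: field_simps)
  moreover have "(X::real) / (4 * k * w) = (X / 2) / (2 * k * w)" for X k w by simp
  moreover have "((\<alpha> + 2)\<^sup>2 * w + 8 * (y - \<alpha> * w)) / 2 = (2 - \<alpha>)\<^sup>2 / 2 * w + 4 * y" for w y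
    by (simp add: power2_eq_square field_simps)
  ultimately show ?thesis using assms unfolding \<Delta>_def by (smt (verit) zero_less_power)
qed

text \<open>After a collision at \<open>T\<close>, the left side tends to \<open>T\<close> because
  \<open>a n\<close> does, while \<open>b n\<close> is unbounded. Before one, \<open>a n\<close>
  tends to minus infinity and falls below \<open>T - 1 / E\<close>, which pushes the left side below
  \<open>T - 1\<close>, while \<open>b n\<close> tends to \<open>T\<close>. Either end of the half
  line thus provides any prescribed ratio \<open>E\<close>.\<close>

lemma eventually_long_interval:
  assumes ends: "(Tm = ereal T \<and> Tp = \<infinity>) \<or> (Tm = -\<infinity> \<and> Tp = ereal T)" and E: "0 < E"
    and lim: "(\<lambda>n. ereal (a n)) \<longlonglongrightarrow> Tm" "(\<lambda>n. ereal (b n)) \<longlonglongrightarrow> Tp"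
  shows "\<forall>\<^sub>F n in sequentially. T + (a n - T) * E \<le> b n"
  using ends
proof
  assume *: "Tm = ereal T \<and> Tp = \<infinity>"
  then have "a \<longlonglongrightarrow> T" "filterlim b at_top sequentially"
    using lim by (simp_all add: tendsto_PInfty_eq_at_top)
  then have "(\<lambda>n. T + (a n - T) * E) \<longlonglongrightarrow> T + (T - T) * E" by (intro tendsto_intros)
  then have "\<forall>\<^sub>F n in sequentially. T + (a n - T) * E < T + 1" by (rule order_tendstoD) simp
  moreover have "\<forall>\<^sub>F n in sequentially. T + 1 \<le> b n"
    using \<open>filterlim b at_top sequentially\<close> by (simp add: filterlim_at_top)
  ultimately show ?thesis by eventually_elim linarith
next
  assume *: "Tm = -\<infinity> \<and> Tp = ereal T"
  then have b: "b \<longlonglongrightarrow> T" using lim by simp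
  have "(\<lambda>n. ereal (a n)) \<longlonglongrightarrow> -\<infinity>" using lim(1) * by simp
  then have "\<forall>\<^sub>F n in sequentially. ereal (a n) < ereal (T - 1 / E)"
    unfolding tendsto_MInfty by blast
  then have "\<forall>\<^sub>F n in sequentially. a n \<le> T - 1 / E" by (rule eventually_mono) simp
  moreover have "\<forall>\<^sub>F n in sequentially. T - 1 < b n" using b by (rule order_tendstoD) simp
  ultimately show ?thesis
  proof eventually_elim
    case (elim n)
    then have "(a n - T) * E \<le> - 1 / E * E" using E by (intro mult_right_mono) auto
    with elim(2) E show ?case by simp
  qed
qed

theorem theorem1p3:
  fixes \<alpha> :: real and \<UU> :: "real^2 \<Rightarrow> real" and U :: "real^2 \<Rightarrow> real"
    and x :: "real \<Rightarrow> real^2" and r :: "real \<Rightarrow> real" and \<theta>\<^sub>0 :: real and Tm Tp :: ereal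
  assumes "0 < \<alpha>" and "\<alpha> < 2"
    and "C2_circle \<UU>" and "\<And>p. norm p = 1 \<Longrightarrow> 0 < \<UU> p"
    and "U = potential \<alpha> \<UU>"
    and "deriv (angular \<UU>) \<theta>\<^sub>0 = 0"
    and "maximal_solution U x Tm Tp"
    and "zero_energy U x Tm Tp"
    and "\<And>t. t \<in> einterval Tm Tp \<Longrightarrow> 0 < r t \<and> x t = r t *\<^sub>R circle_point \<theta>\<^sub>0"
  shows "(\<Delta> \<alpha> \<UU> \<theta>\<^sub>0 < 0 \<longrightarrow> has_morse_index U x Tm Tp \<infinity>)
       \<and> (\<Delta> \<alpha> \<UU> \<theta>\<^sub>0 \<ge> 0 \<longrightarrow> has_morse_index U x Tm Tp 0)"
proof -
  note \<alpha> = assms(1) and \<UU> = assms(3) assms(6) and r = assms(9)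
  let ?A = "2 * \<alpha> * (\<alpha> + 1) / (\<alpha> + 2)\<^sup>2"
  define \<beta> where "\<beta> = 2 * (deriv (deriv (angular \<UU>)) \<theta>\<^sub>0 - \<alpha> * angular \<UU> \<theta>\<^sub>0) / ((\<alpha> + 2)\<^sup>2 * angular \<UU> \<theta>\<^sub>0)"
  have u: "0 < angular \<UU> \<theta>\<^sub>0" using assms(4) by (simp add: angular_def)
  have c: "0 < 2 * (\<alpha> + 2)\<^sup>2 * angular \<UU> \<theta>\<^sub>0" using u \<alpha> by simp
  have \<beta>: "1/4 + \<beta> = \<Delta> \<alpha> \<UU> \<theta>\<^sub>0 / (2 * (\<alpha> + 2)\<^sup>2 * angular \<UU> \<theta>\<^sub>0)"
    unfolding \<beta>_def by (rule \<Delta>_hardy_constant[OF \<alpha> u])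
  obtain v T where v: "\<And>t. t \<in> einterval Tm Tp \<Longrightarrow> (x has_vector_derivative v t) (at t)"
    "continuous_on (einterval Tm Tp) v" "continuous_on (einterval Tm Tp) r"
    and ends: "(Tm = ereal T \<and> Tp = \<infinity>) \<or> (Tm = -\<infinity> \<and> Tp = ereal T)"
    and kepler: "\<And>t. t \<in> einterval Tm Tp \<Longrightarrow>
      r t powr (- \<alpha> - 2) = 2 / ((\<alpha> + 2)\<^sup>2 * angular \<UU> \<theta>\<^sub>0 * (t - T)\<^sup>2)"
    using homothetic_maximal_interval[OF \<alpha> \<UU> u assms(7,8)[unfolded assms(5)] r] by metis
  have sub: "{a..b} \<subseteq> einterval Tm Tp" if "Tm < ereal a" "ereal b < Tp" for a b
    using that unfolding subset_iff einterval_iff atLeastAtMost_iff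
    by (metis ereal_less_eq(3) le_less_trans less_le_trans)
  have d2: "inverse_square_variation U x \<theta>\<^sub>0 T ?A \<beta> a b" if "Tm < ereal a" "ereal b < Tp" for a b
    unfolding assms(5) \<beta>_def
    by (rule homothetic_inverse_square_variation[OF \<alpha> \<UU> u, of a b x v r])
      (use sub[OF that] v r kepler in \<open>auto intro: continuous_on_subset\<close>)
  have T: "T \<notin> einterval Tm Tp" using ends by (auto simp: einterval_iff)
  show ?thesis
  proof (intro conjI impI)
    assume "\<Delta> \<alpha> \<UU> \<theta>\<^sub>0 \<ge> 0"
    then have "0 \<le> 1/4 + \<beta>" unfolding \<beta> using c by (rule divide_nonneg_pos)
    then have "- 1/4 \<le> \<beta>" by linarith
    moreover have "0 \<le> ?A" using \<alpha> by simp
    ultimately have "morse_index_on U x a b = 0" if "Tm < ereal a" "a < b" "ereal b < Tp" for a b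
      using that sub[of a b] T d2[of a b]
      by (intro morse_index_on_eq_0 inverse_square_variation_nonneg[of a b T ?A \<beta>]) auto
    then show "has_morse_index U x Tm Tp 0" unfolding has_morse_index_def by simp
  next
    assume "\<Delta> \<alpha> \<UU> \<theta>\<^sub>0 < 0"
    then have neg: "1/4 + \<beta> < 0" unfolding \<beta> using c by (rule divide_neg_pos)
    \<comment> \<open>The square of \<open>\<omega>\<close> is half of the available gap, so
      \<open>1/4 + \<beta> + \<omega>^2\<close> is still negative, equal to half of
      \<open>1/4 + \<beta>\<close>. The sign is that of \<open>t - T\<close> on the domain.\<close>
    define \<omega> where "\<omega> = (if Tp = \<infinity> then 1 else -1) * sqrt (- (1/4 + \<beta>) / 2)"
    have "\<omega>\<^sup>2 = - (1/4 + \<beta>) / 2" using neg by (simp add: \<omega>_def power_mult_distrib)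
    with neg have \<omega>: "1/4 + \<beta> + \<omega>\<^sup>2 < 0" by simp
    have sgn: "0 < \<omega> * (t - T)" if "t \<in> einterval Tm Tp" for t
    proof -
      have "0 < sqrt (- (1/4 + \<beta>) / 2)" using neg by simp
      with ends that show ?thesis
        by (auto simp: \<omega>_def einterval_iff zero_less_mult_iff)
    qed
    show "has_morse_index U x Tm Tp \<infinity>"
      unfolding has_morse_index_def
    proof (intro allI impI)
      fix a b :: "nat \<Rightarrow> real"
      assume ab: "\<forall>n. Tm < ereal (a n) \<and> a n < b n \<and> ereal (b n) < Tp"
        and lim: "(\<lambda>n. ereal (a n)) \<longlonglongrightarrow> Tm" "(\<lambda>n. ereal (b n)) \<longlonglongrightarrow> Tp"
      \<comment> \<open>\<open>N\<close> is fixed before \<open>n\<close> grows, so the required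
        ratio of times is a constant that the exhausting intervals eventually exceed.\<close>
      have ge: "\<forall>\<^sub>F n in sequentially. enat N \<le> morse_index_on U x (a n) (b n)" for N
      proof -
        have "\<forall>\<^sub>F n in sequentially. T + (a n - T) * exp (real N * pi / \<omega>) \<le> b n"
          by (rule eventually_long_interval[OF ends _ lim]) simp
        then show ?thesis
        proof eventually_elim
          case (elim n)
          have n: "Tm < ereal (a n)" "a n < b n" "ereal (b n) < Tp" using ab by blast+
          show ?case
          proof (rule morse_index_on_ge_oscillations[OF _ _ \<omega> elim d2[OF n(1,3)]])
            show "a n \<le> b n" using n(2) by simp
            show "0 < \<omega> * (t - T)" if "t \<in> {a n..b n}" for t
              using sub[OF n(1,3)] that by (intro sgn) blast
          qed
        qed
      qed
      show "(\<lambda>n. morse_index_on U x (a n) (b n)) \<longlonglongrightarrow> \<infinity>"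
      proof (rule order_tendstoI)
        fix y :: enat assume "y < \<infinity>"
        then obtain m where m: "y = enat m" by auto
        \<comment> \<open>\<open>Suc m\<close> turns the weak lower bound into the strict one that
          the order topology asks for.\<close>
        from ge[of "Suc m"] show "\<forall>\<^sub>F n in sequentially. y < morse_index_on U x (a n) (b n)"
        proof eventually_elim
          case (elim n)
          have "y < enat (Suc m)" by (simp add: m)
          then show ?case using elim by (rule less_le_trans)
        qed
      next
        fix y :: enat assume "\<infinity> < y"
        then show "\<forall>\<^sub>F n in sequentially. morse_index_on U x (a n) (b n) < y" by simp
      qed
    qed
  qed
qed

end
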